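(* Let $k$ be a field, $R=k[x_1,\dots,x_n]$, $d\ge1$, $1\le r\le n$, $k_1<\dots<k_r$ elements of $[n]$, and suppose $\deg\operatorname{lcm}(x_{k_s}^d,x_{k_t}^d)\ge d+2$ for all $s\neq t$. Put $B=\{d\epsilon_{k_1},\dots,d\epsilon_{k_r}\}$. Let $K'$ be the equigenerated monomial ideal whose complementary ideal is $\overline{K'}=(x_{k_1}^d,\dots,x_{k_r}^d)$, i.e. $K'$ is generated by all monomials of degree $d$ other than $x_{k_1}^d,\dots,x_{k_r}^d$. Then the minimal free resolution of $R/K'$ is the complex $$0\to L_d^{n-1,B}\xrightarrow{\mathrm{Kos}^\psi\otimes1}\cdots\xrightarrow{\mathrm{Kos}^\psi\otimes1}L_d^{0,B}\xrightarrow{S_d(\psi)}R\to0 .$$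
   Context: $F=\bigoplus_{i=1}^n Re_i$, $\psi:F\to R$, $e_i\mapsto x_i$. For $\beta\in\mathbb{Z}_{\ge0}^n$: $|\beta|=\sum\beta_i$, $x^\beta=\prod x_i^{\beta_i}$, $e^\beta=\prod e_i^{\beta_i}\in S_{|\beta|}(F)$ (symmetric power), $\operatorname{Supp}(\beta)=\{i:\beta_i>0\}$; $\epsilon_i$ is the $i$th unit vector. For $A=\{a_0<\dots<a_m\}\subseteq[n]$: $e_A=e_{a_0}\wedge\cdots\wedge e_{a_m}$ and $\operatorname{sgn}(a_j\in A)=(-1)^j$. $\mathrm{Kos}^\psi:\bigwedge^iF\to\bigwedge^{i-1}F$, $e_A\mapsto\sum_{a\in A}\operatorname{sgn}(a\in A)x_ae_{A\setminus a}$. Let $\kappa_{a,b}:\bigwedge^aF\otimes S_b(F)\to\bigwedge^{a-1}F\otimes S_{b+1}(F)$, $e_A\otimes e^\beta\mapsto\sum_{a\in A}\operatorname{sgn}(a\in A)\,e_{A\setminus a}\otimes e_ae^\beta$, and $L_d^i=\ker\kappa_{i,d}\subseteq\bigwedge^iF\otimes S_d(F)$ (so $L_d^0=S_d(F)$); $\mathrm{Kos}^\psi\otimes1$ restricts to maps $L_d^i\to L_d^{i-1}$. For $|A|=i+1$, $|\beta|=d-1$, the symbol $e_A\otimes e^\beta$ as an element of $L_d^i$ denotes $\kappa_{i+1,d-1}(e_A\otimes e^\beta)$; it is standard if $\min A\le\min\operatorname{Supp}(\beta)$ (no condition if $d=1$), and the standard elements form a basis of $L_d^i$. $S_d(\psi):S_d(F)\to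 R$ sends $e^\beta\mapsto x^\beta$. For $B=\{d\epsilon_{k_1},\dots,d\epsilon_{k_r}\}$, $L_d^{i,B}\subseteq L_d^i$ ($i\ge 0$) is the free submodule spanned by all standard basis elements of $L_d^i$ except those of the form $e_{\{k_s\}\cup J}\otimes e_{k_s}^{d-1}$ with $k_s\notin J$, $1\le s\le r$. *)

theory Defs
  imports Complex_Main "HOL-Library.Poly_Mapping" "HOL-Library.Cardinality"
begin

text \<open>
  The variables are indexed by a finite linearly ordered type \<open>'n\<close>, which plays the role of
  the ordered set \<open>[n]\<close>; thus \<open>n = CARD('n)\<close>. Exponent vectors are elements of
  \<open>'n \<Rightarrow>\<^sub>0 nat\<close>, and \<open>R = k[x\<^sub>1,\<dots>,x\<^sub>n]\<close> is the monoid algebra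
  \<open>('n \<Rightarrow>\<^sub>0 nat) \<Rightarrow>\<^sub>0 'k\<close> with the convolution product of the library.
\<close>

type_synonym 'n expo = "'n \<Rightarrow>\<^sub>0 nat"

type_synonym ('n, 'k) mpoly = "'n expo \<Rightarrow>\<^sub>0 'k"

abbreviation unit_expo :: "'n \<Rightarrow> 'n expo" where
  "unit_expo i \<equiv> Poly_Mapping.single i 1"

definition expo_deg :: "'n expo \<Rightarrow> nat" where
  "expo_deg \<beta> = (\<Sum>i\<in>Poly_Mapping.keys \<beta>. Poly_Mapping.lookup \<beta> i)"

lift_definition expo_lcm :: "'n expo \<Rightarrow> 'n expo \<Rightarrow> 'n expo"
  is "\<lambda>\<alpha> \<beta> i. max (\<alpha> i) (\<beta> i)"
proof -
  fix \<alpha> \<beta> :: "'n \<Rightarrow> nat"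
  assume "finite {i. \<alpha> i \<noteq> 0}" "finite {i. \<beta> i \<noteq> 0}"
  then show "finite {i. max (\<alpha> i) (\<beta> i) \<noteq> 0}"
    by (rule finite_subset[rotated, OF finite_UnI]) auto
qed

definition monomial :: "'n expo \<Rightarrow> ('n, 'k::field) mpoly" where
  "monomial \<beta> = Poly_Mapping.single \<beta> 1"

abbreviation var :: "'n \<Rightarrow> ('n, 'k::field) mpoly" where
  "var i \<equiv> monomial (unit_expo i)"

abbreviation ideal_gen :: "('n, 'k::field) mpoly set \<Rightarrow> ('n, 'k) mpoly set" where
  "ideal_gen \<equiv> module.span (*)"

definition irrelevant_ideal :: "('n, 'k::field) mpoly set" where
  "irrelevant_ideal = ideal_gen (range var)"

definition poly_homog :: "nat \<Rightarrow> ('n, 'k::field) mpoly set" where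
  "poly_homog j = {p. \<forall>\<alpha>\<in>Poly_Mapping.keys p. expo_deg \<alpha> = j}"

text \<open>
  For a set \<open>B\<close> of exponent vectors of degree \<open>d\<close>: the equigenerated monomial ideal whose
  complementary ideal is generated by the monomials \<open>x\<^sup>\<beta>\<close>, \<open>\<beta> \<in> B\<close>.
\<close>

definition ideal_with_complement :: "nat \<Rightarrow> 'n expo set \<Rightarrow> ('n, 'k::field) mpoly set" where
  "ideal_with_complement d B = ideal_gen (monomial ` {\<beta>. expo_deg \<beta> = d \<and> \<beta> \<notin> B})"


section \<open>Minimal graded free resolutions of \<open>R/I\<close>\<close>

text \<open>
  All modules below are submodules of one ambient \<open>R\<close>-module of type \<open>'m\<close> with scalar
  multiplication \<open>s\<close>, whose component of degree \<open>j\<close> is \<open>H j\<close>.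
\<close>

definition linear_map_on ::
  "('r \<Rightarrow> 'a \<Rightarrow> 'a) \<Rightarrow> ('r \<Rightarrow> 'b \<Rightarrow> 'b) \<Rightarrow> 'a::ab_group_add set \<Rightarrow> ('a \<Rightarrow> 'b::ab_group_add) \<Rightarrow> bool" where
  "linear_map_on s t U f \<longleftrightarrow>
     (\<forall>x\<in>U. \<forall>y\<in>U. f (x + y) = f x + f y) \<and> (\<forall>c. \<forall>x\<in>U. f (s c x) = t c (f x))"

definition graded_free ::
  "(('n, 'k::field) mpoly \<Rightarrow> 'm \<Rightarrow> 'm) \<Rightarrow> (nat \<Rightarrow> 'm::ab_group_add set) \<Rightarrow> 'm set \<Rightarrow> bool" where
  "graded_free s H U \<longleftrightarrow>
     (\<exists>E. finite E \<and> E \<subseteq> (\<Union>j. H j) \<and> \<not> module.dependent s E \<and> module.span s E = U)"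

definition irrelevant_mult ::
  "(('n, 'k::field) mpoly \<Rightarrow> 'm \<Rightarrow> 'm) \<Rightarrow> 'm::ab_group_add set \<Rightarrow> 'm set" where
  "irrelevant_mult s U = module.span s {s c u | c u. c \<in> irrelevant_ideal \<and> u \<in> U}"

text \<open>
  The complex
  \<open>0 \<rightarrow> G N \<rightarrow> \<dots> \<rightarrow> G 1 \<rightarrow> G 0 \<rightarrow> R \<rightarrow> 0\<close>
  with differentials \<open>D i : G i \<rightarrow> G (i - 1)\<close> for \<open>1 \<le> i \<le> N\<close> and
  \<open>\<epsilon> : G 0 \<rightarrow> R\<close> is the minimal graded free resolution of \<open>R/I\<close>: all terms are graded free
  modules of finite rank, all maps are \<open>R\<close>-linear of degree \<open>0\<close>, the homology at \<open>R\<close> is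
  \<open>R/I\<close> (the image of \<open>\<epsilon>\<close> is \<open>I\<close>), the complex is exact elsewhere, and each map has
  image in the irrelevant ideal times its target. The set \<open>incoming N G D i\<close> is the image in
  \<open>G i\<close> of the preceding term, which is \<open>0\<close> for \<open>i = N\<close>.
\<close>

definition incoming ::
  "nat \<Rightarrow> (nat \<Rightarrow> 'm::ab_group_add set) \<Rightarrow> (nat \<Rightarrow> 'm \<Rightarrow> 'm) \<Rightarrow> nat \<Rightarrow> 'm set" where
  "incoming N G D i = (if i = N then {0} else D (Suc i) ` G (Suc i))"

definition minimal_free_resolution_of_quotient ::
  "(('n, 'k::field) mpoly \<Rightarrow> 'm \<Rightarrow> 'm) \<Rightarrow> (nat \<Rightarrow> 'm::ab_group_add set) \<Rightarrow> nat \<Rightarrow>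
   (nat \<Rightarrow> 'm set) \<Rightarrow> (nat \<Rightarrow> 'm \<Rightarrow> 'm) \<Rightarrow> ('m \<Rightarrow> ('n, 'k) mpoly) \<Rightarrow> ('n, 'k) mpoly set \<Rightarrow> bool" where
  "minimal_free_resolution_of_quotient s H N G D \<epsilon> I \<longleftrightarrow>
     module s \<and>
     (\<forall>i\<le>N. graded_free s H (G i)) \<and>
     linear_map_on s (*) (G 0) \<epsilon> \<and>
     (\<forall>j. \<epsilon> ` (G 0 \<inter> H j) \<subseteq> poly_homog j) \<and>
     (\<forall>i\<in>{1..N}. linear_map_on s s (G i) (D i) \<and> D i ` G i \<subseteq> G (i - 1) \<and>
                 (\<forall>j. D i ` (G i \<inter> H j) \<subseteq> H j)) \<and>
     \<epsilon> ` G 0 = I \<and>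
     {x \<in> G 0. \<epsilon> x = 0} = incoming N G D 0 \<and>
     (\<forall>i\<in>{1..N}. {x \<in> G i. D i x = 0} = incoming N G D i) \<and>
     \<epsilon> ` G 0 \<subseteq> irrelevant_ideal \<and>
     (\<forall>i\<in>{1..N}. D i ` G i \<subseteq> irrelevant_mult s (G (i - 1)))"


section \<open>The module \<open>\<And>F \<otimes> S(F)\<close> and the maps \<open>\<kappa>\<close>, \<open>Kos\<^sup>\<psi> \<otimes> 1\<close>, \<open>S(\<psi>)\<close>\<close>

text \<open>
  \<open>\<And>F \<otimes> S(F)\<close> is the free \<open>R\<close>-module on the symbols \<open>e\<^sub>A \<otimes> e\<^sup>\<beta>\<close>, represented by the pairs
  \<open>(A, \<beta>)\<close>. Its bihomogeneous part \<open>\<And>\<^sup>aF \<otimes> S\<^sub>b(F)\<close> is \<open>exsym_part a b\<close>.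
\<close>

type_synonym ('n, 'k) exsym = "('n set \<times> 'n expo) \<Rightarrow>\<^sub>0 ('n, 'k) mpoly"

definition exsym_scale :: "('n, 'k::field) mpoly \<Rightarrow> ('n, 'k) exsym \<Rightarrow> ('n, 'k) exsym" where
  "exsym_scale c f = Poly_Mapping.map ((*) c) f"

definition exsym_basis :: "'n set \<Rightarrow> 'n expo \<Rightarrow> ('n, 'k::field) exsym" where
  "exsym_basis A \<beta> = Poly_Mapping.single (A, \<beta>) 1"

definition exsym_part :: "nat \<Rightarrow> nat \<Rightarrow> ('n, 'k::field) exsym set" where
  "exsym_part a b = {f. \<forall>(A, \<beta>)\<in>Poly_Mapping.keys f. card A = a \<and> expo_deg \<beta> = b}"

text \<open>
  The internal degree: each \<open>e\<^sub>i\<close> has the degree \<open>1\<close> of its image \<open>x\<^sub>i\<close> under \<open>\<psi>\<close>.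
\<close>

definition exsym_homog :: "nat \<Rightarrow> ('n, 'k::field) exsym set" where
  "exsym_homog j = {f. \<forall>(A, \<beta>)\<in>Poly_Mapping.keys f.
     \<forall>\<alpha>\<in>Poly_Mapping.keys (Poly_Mapping.lookup f (A, \<beta>)).
       expo_deg \<alpha> + card A + expo_deg \<beta> = j}"

text \<open>The \<open>R\<close>-linear map with prescribed values on the symbols \<open>e\<^sub>A \<otimes> e\<^sup>\<beta>\<close>.\<close>

definition exsym_extend ::
  "(('n, 'k::field) mpoly \<Rightarrow> 'b \<Rightarrow> 'b) \<Rightarrow> ('n set \<Rightarrow> 'n expo \<Rightarrow> 'b::ab_group_add) \<Rightarrow> ('n, 'k) exsym \<Rightarrow> 'b" where
  "exsym_extend s v f =
     (\<Sum>(A, \<beta>)\<in>Poly_Mapping.keys f. s (Poly_Mapping.lookup f (A, \<beta>)) (v A \<beta>))"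

text \<open>\<open>sgn (a\<^sub>j \<in> A) = (-1)\<^sup>j\<close>, where \<open>j\<close> is the number of elements of \<open>A\<close> below \<open>a\<^sub>j\<close>.\<close>

definition sgn_in :: "'n::linorder \<Rightarrow> 'n set \<Rightarrow> ('n, 'k::field) mpoly" where
  "sgn_in a A = (-1) ^ card {b \<in> A. b < a}"

definition kappa_symbol :: "'n::linorder set \<Rightarrow> 'n expo \<Rightarrow> ('n, 'k::field) exsym" where
  "kappa_symbol A \<beta> =
     (\<Sum>a\<in>A. exsym_scale (sgn_in a A) (exsym_basis (A - {a}) (unit_expo a + \<beta>)))"

definition kappa :: "('n::linorder, 'k::field) exsym \<Rightarrow> ('n, 'k) exsym" where
  "kappa = exsym_extend exsym_scale kappa_symbol"

definition kos :: "('n::linorder, 'k::field) exsym \<Rightarrow> ('n, 'k) exsym" where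
  "kos = exsym_extend exsym_scale
     (\<lambda>A \<beta>. \<Sum>a\<in>A. exsym_scale (sgn_in a A * var a) (exsym_basis (A - {a}) \<beta>))"

text \<open>
  \<open>S\<^sub>d(\<psi>)\<close> on \<open>S\<^sub>d(F) = \<And>\<^sup>0F \<otimes> S\<^sub>d(F)\<close>; its values on symbols with \<open>A \<noteq> {}\<close> are irrelevant.
\<close>

definition sym_psi :: "('n, 'k::field) exsym \<Rightarrow> ('n, 'k) mpoly" where
  "sym_psi = exsym_extend (*) (\<lambda>A \<beta>. monomial \<beta>)"


section \<open>The modules \<open>L\<^sub>d\<^sup>i\<close> and \<open>L\<^sub>d\<^sup>i\<^sup>,\<^sup>B\<close>\<close>

definition L_module :: "nat \<Rightarrow> nat \<Rightarrow> ('n::linorder, 'k::field) exsym set" where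
  "L_module d i = {f \<in> exsym_part i d. kappa f = 0}"

definition standard :: "nat \<Rightarrow> nat \<Rightarrow> ('n::linorder set \<times> 'n expo) set" where
  "standard d i = {(A, \<beta>). card A = i + 1 \<and> expo_deg \<beta> = d - 1 \<and>
     (d = 1 \<or> Min A \<le> Min (Poly_Mapping.keys \<beta>))}"

definition excluded :: "nat \<Rightarrow> 'n expo set \<Rightarrow> ('n set \<times> 'n expo) set" where
  "excluded d B = {(insert k J, Poly_Mapping.single k (d - 1)) | k J.
     Poly_Mapping.single k d \<in> B \<and> k \<notin> J}"

text \<open>
  As an element of \<open>L\<^sub>d\<^sup>i\<close> the symbol \<open>e\<^sub>A \<otimes> e\<^sup>\<beta>\<close> (with \<open>card A = i + 1\<close> and
  \<open>expo_deg \<beta> = d - 1\<close>) stands for its image under \<open>\<kappa>\<close>, not for \<open>exsym_basis A \<beta>\<close>.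
\<close>

definition LB :: "nat \<Rightarrow> 'n expo set \<Rightarrow> nat \<Rightarrow> ('n::linorder, 'k::field) exsym set" where
  "LB d B i = module.span exsym_scale
     ((\<lambda>(A, \<beta>). kappa (exsym_basis A \<beta>)) ` (standard d i - excluded d B))"


section \<open>Basic facts: \<open>\<kappa> \<circ> \<kappa> = 0\<close> and \<open>L\<^sub>d\<^sup>i\<^sup>,\<^sup>B \<subseteq> L\<^sub>d\<^sup>i\<close>\<close>

lemma lookup_exsym_scale [simp]:
  "Poly_Mapping.lookup (exsym_scale c f) x = c * Poly_Mapping.lookup f x"
  by (auto simp: exsym_scale_def Poly_Mapping.map.rep_eq when_def)

lemma module_exsym_scale: "module exsym_scale"
  by unfold_locales (auto intro!: poly_mapping_eqI simp: lookup_add algebra_simps)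

interpretation exsym: module exsym_scale
  by (rule module_exsym_scale)

lemma exsym_extend_superset:
  assumes "module s" "finite S" "Poly_Mapping.keys f \<subseteq> S"
  shows "exsym_extend s v f = (\<Sum>(A, \<beta>)\<in>S. s (Poly_Mapping.lookup f (A, \<beta>)) (v A \<beta>))"
  unfolding exsym_extend_def
  by (rule sum.mono_neutral_left)
     (use assms in \<open>auto simp: in_keys_iff module.scale_zero_left\<close>)

lemma module_hom_exsym_extend:
  assumes "module s"
  shows "module_hom exsym_scale s (exsym_extend s v)"
proof -
  interpret s: module s by fact
  show ?thesis
  proof unfold_locales
    fix f g :: "('a, 'b) exsym"
    let ?S = "Poly_Mapping.keys f \<union> Poly_Mapping.keys g"
    have "Poly_Mapping.keys (f + g) \<subseteq> ?S" by (rule Poly_Mapping.keys_add)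
    then show "exsym_extend s v (f + g) = exsym_extend s v f + exsym_extend s v g"
      by (simp add: exsym_extend_superset[OF assms, of ?S] lookup_add s.scale_left_distrib
          sum.distrib case_prod_beta)
  next
    fix c :: "('a, 'b) mpoly" and f :: "('a, 'b) exsym"
    have "Poly_Mapping.keys (exsym_scale c f) \<subseteq> Poly_Mapping.keys f" by (auto simp: in_keys_iff)
    then show "exsym_extend s v (exsym_scale c f) = s c (exsym_extend s v f)"
      by (simp add: exsym_extend_superset[OF assms, of "Poly_Mapping.keys f"]
          s.scale_sum_right case_prod_beta)
  qed
qed

lemma exsym_extend_basis [simp]:
  assumes "module s"
  shows "exsym_extend s v (exsym_basis A \<beta>) = v A \<beta>"
proof -
  interpret s: module s by fact
  show ?thesis by (simp add: exsym_extend_def exsym_basis_def)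
qed

interpretation kappa: module_hom exsym_scale exsym_scale kappa
  unfolding kappa_def by (rule module_hom_exsym_extend) (rule module_exsym_scale)

lemma kappa_basis: "kappa (exsym_basis A \<beta>) = kappa_symbol A \<beta>"
  by (simp add: kappa_def module_exsym_scale)

lemma sgn_in_swap:
  assumes "finite A" "a \<in> A" "b \<in> A" "a < b"
  shows "sgn_in a A * sgn_in b (A - {a}) = - (sgn_in b A * sgn_in a (A - {b}))"
proof -
  have 1: "{c \<in> A - {b}. c < a} = {c \<in> A. c < a}" using assms by auto
  have 2: "{c \<in> A. c < b} = insert a {c \<in> A - {a}. c < b}" using assms by auto
  have 3: "card {c \<in> A. c < b} = Suc (card {c \<in> A - {a}. c < b})"
    unfolding 2 using assms by simp
  show ?thesis unfolding sgn_in_def 1 3 by simp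
qed

lemma kappa_kappa_basis:
  fixes A :: "'n::linorder set"
  assumes "finite A"
  shows "kappa (kappa (exsym_basis A \<beta> :: ('n, 'k::field) exsym)) = 0"
proof -
  define t :: "'n \<Rightarrow> 'n \<Rightarrow> ('n, 'k) exsym" where "t a b = exsym_scale (sgn_in a A * sgn_in b (A - {a}))
    (exsym_basis (A - {a} - {b}) (unit_expo b + (unit_expo a + \<beta>)))" for a b
  have sw: "t b a = - t a b" if "a \<in> A" "b \<in> A" "a < b" for a b
  proof -
    have "A - {b} - {a} = A - {a} - {b}" by auto
    moreover have "unit_expo a + (unit_expo b + \<beta>) = unit_expo b + (unit_expo a + \<beta>)"
      by (simp add: add_ac)
    moreover have "(sgn_in b A :: ('n, 'k) mpoly) * sgn_in a (A - {b}) = - (sgn_in a A * sgn_in b (A - {a}))"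
      by (subst sgn_in_swap[OF assms that]) simp
    ultimately show ?thesis unfolding t_def by (simp only: exsym.scale_minus_left)
  qed
  have "kappa (kappa (exsym_basis A \<beta> :: ('n, 'k) exsym)) = (\<Sum>a\<in>A. \<Sum>b\<in>A - {a}. t a b)"
    by (simp add: kappa_basis kappa_symbol_def kappa.sum kappa.scale exsym.scale_sum_right t_def)
  also have "\<dots> = (\<Sum>a\<in>A. \<Sum>b\<in>{b \<in> A. a < b}. t a b) + (\<Sum>a\<in>A. \<Sum>b\<in>{b \<in> A. b < a}. t a b)"
    unfolding sum.distrib[symmetric]
  proof (rule sum.cong[OF refl])
    fix a
    have "A - {a} = {b \<in> A. a < b} \<union> {b \<in> A. b < a}" by auto
    also have "(\<Sum>b\<in>\<dots>. t a b) = (\<Sum>b\<in>{b \<in> A. a < b}. t a b) + (\<Sum>b\<in>{b \<in> A. b < a}. t a b)"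
      by (rule sum.union_disjoint) (use assms in auto)
    finally show "(\<Sum>b\<in>A - {a}. t a b) =
        (\<Sum>b\<in>{b \<in> A. a < b}. t a b) + (\<Sum>b\<in>{b \<in> A. b < a}. t a b)" .
  qed
  also have "(\<Sum>a\<in>A. \<Sum>b\<in>{b \<in> A. b < a}. t a b) = (\<Sum>b\<in>A. \<Sum>a\<in>{a \<in> A. b < a}. t a b)"
    by (rule sum.swap_restrict[OF assms assms])
  also have "\<dots> = (\<Sum>a\<in>A. \<Sum>b\<in>{b \<in> A. a < b}. - t a b)"
    by (intro sum.cong refl) (auto simp: sw)
  finally show ?thesis by (simp add: sum_negf)
qed

lemma expo_deg_superset:
  assumes "finite S" "Poly_Mapping.keys \<beta> \<subseteq> S"
  shows "expo_deg \<beta> = (\<Sum>i\<in>S. Poly_Mapping.lookup \<beta> i)"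
  unfolding expo_deg_def
  by (rule sum.mono_neutral_left) (use assms in \<open>auto simp: in_keys_iff\<close>)

lemma expo_deg_add: "expo_deg (\<alpha> + \<beta>) = expo_deg \<alpha> + expo_deg \<beta>"
proof -
  let ?S = "Poly_Mapping.keys \<alpha> \<union> Poly_Mapping.keys \<beta>"
  have "Poly_Mapping.keys (\<alpha> + \<beta>) \<subseteq> ?S" by (rule Poly_Mapping.keys_add)
  then show ?thesis
    by (simp add: expo_deg_superset[of ?S] lookup_add sum.distrib)
qed

lemma expo_deg_single: "expo_deg (Poly_Mapping.single a m) = m"
  by (simp add: expo_deg_def)

lemma subspace_exsym_part: "exsym.subspace (exsym_part a b :: ('n, 'k::field) exsym set)"
proof -
  have *: "f \<in> exsym_part a b \<longleftrightarrow>
      (\<forall>A \<beta>. Poly_Mapping.lookup f (A, \<beta>) \<noteq> 0 \<longrightarrow> card A = a \<and> expo_deg \<beta> = b)"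
    for f :: "('n, 'k) exsym"
    unfolding exsym_part_def by (simp add: Ball_def in_keys_iff)
  show ?thesis
  proof (rule exsym.subspaceI)
    fix f g :: "('n, 'k) exsym"
    assume f: "f \<in> exsym_part a b" and g: "g \<in> exsym_part a b"
    show "f + g \<in> exsym_part a b"
      unfolding *
    proof (intro allI impI)
      fix A \<beta>
      assume "Poly_Mapping.lookup (f + g) (A, \<beta>) \<noteq> 0"
      then have "Poly_Mapping.lookup f (A, \<beta>) \<noteq> 0 \<or> Poly_Mapping.lookup g (A, \<beta>) \<noteq> 0"
        by (auto simp: lookup_add)
      then show "card A = a \<and> expo_deg \<beta> = b"
        using f g unfolding * by blast
    qed
  next
    fix c and f :: "('n, 'k) exsym"
    assume f: "f \<in> exsym_part a b"
    show "exsym_scale c f \<in> exsym_part a b"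
      unfolding *
    proof (intro allI impI)
      fix A \<beta>
      assume "Poly_Mapping.lookup (exsym_scale c f) (A, \<beta>) \<noteq> 0"
      then have "Poly_Mapping.lookup f (A, \<beta>) \<noteq> 0"
        by auto
      then show "card A = a \<and> expo_deg \<beta> = b"
        using f unfolding * by blast
    qed
  qed (simp add: *)
qed

lemma kappa_in_part:
  assumes "card A = i + 1" "expo_deg \<beta> = d - 1" "1 \<le> d"
  shows "kappa (exsym_basis A \<beta>) \<in> exsym_part i d"
  unfolding kappa_basis kappa_symbol_def
proof (intro exsym.subspace_sum exsym.subspace_scale subspace_exsym_part)
  fix a assume "a \<in> A"
  then show "exsym_basis (A - {a}) (unit_expo a + \<beta>) \<in> exsym_part i d"
    using assms by (auto simp: exsym_part_def exsym_basis_def expo_deg_add expo_deg_single)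
qed

lemma subspace_L: "exsym.subspace (L_module d i)"
  using subspace_exsym_part[of i d]
  by (auto simp: L_module_def exsym.subspace_def kappa.add kappa.scale)

lemma LB_subset_L:
  assumes "1 \<le> d"
  shows "LB d B i \<subseteq> L_module d i"
  unfolding LB_def
proof (rule exsym.span_minimal[OF _ subspace_L], clarify)
  fix A :: "'a set" and \<beta> :: "'a expo"
  assume "(A, \<beta>) \<in> standard d i"
  then have "card A = i + 1" "expo_deg \<beta> = d - 1" by (auto simp: standard_def)
  moreover from this have "finite A" by (metis card.infinite add_is_0 one_neq_zero)
  ultimately show "kappa (exsym_basis A \<beta>) \<in> L_module d i"
    using assms kappa_in_part[of A i \<beta> d] kappa_kappa_basis[of A \<beta>] by (simp add: L_module_def)
qed

end

theory Submission
  imports Defs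
begin

text \<open>
  Both \<open>Kos\<^sup>\<psi> \<otimes> 1\<close> and \<open>\<kappa>\<close> are Koszul differentials, one with respect to the monomials of the
  coefficients and one with respect to the symmetric factor, and they anticommute. Each has an explicit
  \<open>k\<close>-linear contraction: move the smallest occurring index from the monomial to the exterior factor.
  Since \<open>L\<^sub>d\<^sup>i\<close> is the image of \<open>\<kappa>\<close>, induction on \<open>d\<close> shows that the \<open>L\<^sub>d\<^sup>i\<close> form a resolution.

  The module \<open>L\<^sub>d\<^sup>i\<^sup>,\<^sup>B\<close> is the image under \<open>\<kappa>\<close> of all elements without excluded symbols, standard or
  not, and this description makes it obvious that it is a minimal subcomplex. The quotient of the two complexes
  is a direct sum, over the elements \<open>k\<close> with \<open>d\<epsilon>\<^sub>k \<in> B\<close>, of Koszul complexes on the variables other than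
  \<open>x\<^sub>k\<close>. Contracting these corrects a preimage in \<open>L\<^sub>d\<^sup>i\<close> to one in \<open>L\<^sub>d\<^sup>i\<^sup>,\<^sup>B\<close>. The sum is direct because an
  excluded symbol determines its \<open>k\<close>; for \<open>d = 1\<close> this needs the hypothesis on the least common multiples,
  which then forces \<open>r = 1\<close>.
\<close>

\<comment> \<open>Otherwise the simplifier destroys the abbreviation \<open>unit_expo\<close>.\<close>
declare One_nat_def [simp del]

section \<open>A Koszul differential on coefficients and its contraction\<close>

text \<open>\<open>sgn_in\<close> with values in the field instead of the polynomial ring, for
  computing with single coefficients.\<close>

definition sg :: "'n::linorder \<Rightarrow> 'n set \<Rightarrow> 'k::field" where
  "sg a A = (-1) ^ card {b \<in> A. b < a}"

text \<open>
  The Koszul differential in the variables \<open>V\<close> on functions \<open>F\<close>, where \<open>F \<alpha> A\<close> is the coefficient of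
  \<open>x\<^sup>\<alpha> e\<^sub>A\<close>.
\<close>

definition kdiff :: "'n::linorder set \<Rightarrow> ('n expo \<Rightarrow> 'n set \<Rightarrow> 'k::field) \<Rightarrow> 'n expo \<Rightarrow> 'n set \<Rightarrow> 'k" where
  "kdiff V F \<alpha> A =
     (\<Sum>a\<in>V \<inter> Poly_Mapping.keys \<alpha> - A. sg a A * F (\<alpha> - unit_expo a) (insert a A))"

text \<open>The map that moves m from \<alpha> to A, where m is the least index of V that occurs,
  read on coefficients: F is evaluated one move back. If no index of V occurs, \<open>Min\<close> is
  taken of the empty set, but then \<open>A \<inter> V\<close> is empty too and the value is
  0.\<close>

definition kcontract :: "'n::linorder set \<Rightarrow> ('n expo \<Rightarrow> 'n set \<Rightarrow> 'k::field) \<Rightarrow> 'n expo \<Rightarrow> 'n set \<Rightarrow> 'k" where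
  "kcontract V F \<alpha> A =
     (let m = Min ((A \<union> Poly_Mapping.keys \<alpha>) \<inter> V)
      in if m \<in> A \<inter> V then sg m A * F (\<alpha> + unit_expo m) (A - {m}) else 0)"

lemma sg_square: "sg a A * sg a A = 1"
  by (simp add: sg_def flip: power_mult_distrib)

lemma sg_cong: "(\<And>b. b < a \<Longrightarrow> b \<in> A \<longleftrightarrow> b \<in> A') \<Longrightarrow> sg a A = sg a A'"
  by (auto simp: sg_def intro!: arg_cong[where f = card] arg_cong[where f = "(^) _"])

lemma sg_remove:
  fixes A :: "'n::{finite, linorder} set"
  assumes "m \<in> A" "m < a"
  shows "sg a A = - sg a (A - {m})"
proof -
  have "{b \<in> A. b < a} = insert m {b \<in> A - {m}. b < a}" using assms by auto
  then show ?thesis by (simp add: sg_def)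
qed

lemma keys_add_unit: "Poly_Mapping.keys (\<alpha> + unit_expo a) = insert a (Poly_Mapping.keys \<alpha>)"
  for \<alpha> :: "'n expo"
  by (auto simp: in_keys_iff lookup_add lookup_single when_def split: if_splits)

lemma minus_add_unit: "a \<in> Poly_Mapping.keys \<alpha> \<Longrightarrow> \<alpha> - unit_expo a + unit_expo a = \<alpha>"
  for \<alpha> :: "'n expo"
  by (rule poly_mapping_eqI)
     (auto simp: in_keys_iff lookup_add lookup_minus lookup_single when_def)

lemma add_minus_unit: "a \<in> Poly_Mapping.keys \<alpha> \<Longrightarrow> \<alpha> + \<beta> - unit_expo a = \<alpha> - unit_expo a + \<beta>"
  for \<alpha> :: "'n expo"
  by (rule poly_mapping_eqI)
     (auto simp: in_keys_iff lookup_add lookup_minus lookup_single when_def)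

lemma keys_minus_unit:
  "a \<in> Poly_Mapping.keys \<alpha> \<Longrightarrow> insert a (Poly_Mapping.keys (\<alpha> - unit_expo a)) = Poly_Mapping.keys \<alpha>"
  for \<alpha> :: "'n expo"
  by (metis keys_add_unit minus_add_unit)

lemma kdiff_cong:
  "(\<And>a. a \<in> V \<Longrightarrow> a \<in> Poly_Mapping.keys \<alpha> \<Longrightarrow> a \<notin> A \<Longrightarrow> F (\<alpha> - unit_expo a) (insert a A) = G (\<alpha> - unit_expo a) (insert a A))
    \<Longrightarrow> kdiff V F \<alpha> A = kdiff V G \<alpha> A"
  by (auto simp: kdiff_def intro!: sum.cong)

text \<open>If m lies in A, the summand of m in the second term is \<open>F \<alpha> A\<close>,
  since its sign squares to 1, and every other summand cancels against one of the first term, since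
  a > m and removing m flips the sign of a. If m is not in A, the second term is 0 and only the
  summand a = m of the first survives. Nothing is divided by a degree, so the characteristic is
  arbitrary.\<close>

lemma kdiff_kcontract:
  fixes V A :: "'n::{finite, linorder} set" and F :: "'n expo \<Rightarrow> 'n set \<Rightarrow> 'k::field"
  assumes "(A \<union> Poly_Mapping.keys \<alpha>) \<inter> V \<noteq> {}"
  shows "kdiff V (kcontract V F) \<alpha> A + kcontract V (kdiff V F) \<alpha> A = F \<alpha> A"
proof -
  define m where "m = Min ((A \<union> Poly_Mapping.keys \<alpha>) \<inter> V)"
  have m: "m \<in> A \<union> Poly_Mapping.keys \<alpha>" "m \<in> V"
    using Min_in[OF _ assms] by (auto simp: m_def)
  have min: "m \<le> a" if "a \<in> V" "a \<in> Poly_Mapping.keys \<alpha>" for a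
    using that by (auto simp: m_def)
  have TF: "kcontract V F (\<alpha> - unit_expo a) (insert a A) =
      (if m \<in> insert a A then sg m (insert a A) * F (\<alpha> - unit_expo a + unit_expo m) (insert a A - {m}) else 0)"
    if "a \<in> V" "a \<in> Poly_Mapping.keys \<alpha>" "a \<notin> A" for a
  proof -
    \<comment> \<open>Moving a from one factor to the other keeps the set of occurring indices, so
      the minimum is still m.\<close>
    have "insert a A \<union> Poly_Mapping.keys (\<alpha> - unit_expo a) = A \<union> Poly_Mapping.keys \<alpha>"
      using keys_minus_unit[of a \<alpha>] that by blast
    then show ?thesis using m by (simp add: kcontract_def flip: m_def)
  qed
  have KT: "kdiff V (kcontract V F) \<alpha> A = (\<Sum>a\<in>V \<inter> Poly_Mapping.keys \<alpha> - A. sg a A *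
      (if m \<in> insert a A then sg m (insert a A) * F (\<alpha> - unit_expo a + unit_expo m) (insert a A - {m}) else 0))"
    unfolding kdiff_def by (rule sum.cong) (simp_all add: TF)
  show ?thesis
  proof (cases "m \<in> A")
    case True
    have "kcontract V (kdiff V F) \<alpha> A = sg m A * kdiff V F (\<alpha> + unit_expo m) (A - {m})"
      using True m by (simp add: kcontract_def flip: m_def)
    also have "V \<inter> Poly_Mapping.keys (\<alpha> + unit_expo m) - (A - {m}) = insert m (V \<inter> Poly_Mapping.keys \<alpha> - A)"
      using True m by (auto simp: keys_add_unit)
    then have "kdiff V F (\<alpha> + unit_expo m) (A - {m}) = sg m (A - {m}) * F \<alpha> A +
        (\<Sum>a\<in>V \<inter> Poly_Mapping.keys \<alpha> - A. sg a (A - {m}) * F (\<alpha> + unit_expo m - unit_expo a) (insert a (A - {m})))"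
      using True by (simp add: kdiff_def insert_absorb)
    finally have TK: "kcontract V (kdiff V F) \<alpha> A = sg m A * sg m (A - {m}) * F \<alpha> A +
        (\<Sum>a\<in>V \<inter> Poly_Mapping.keys \<alpha> - A. sg m A * (sg a (A - {m}) * F (\<alpha> + unit_expo m - unit_expo a) (insert a (A - {m}))))"
      by (simp add: distrib_left sum_distrib_left mult.assoc)
    have "sg m A * sg m (A - {m}) = (1::'k)"
      by (subst sg_cong[of m "A - {m}" A]) (auto simp: sg_square)
    moreover have "sg m A * (sg a (A - {m}) * F (\<alpha> + unit_expo m - unit_expo a) (insert a (A - {m}))) =
       - (sg a A * (sg m (insert a A) * F (\<alpha> - unit_expo a + unit_expo m) (insert a A - {m})))"
      if "a \<in> V \<inter> Poly_Mapping.keys \<alpha> - A" for a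
    proof -
      have a: "m < a" using that min[of a] True by (auto simp: order_le_less)
      have "\<alpha> + unit_expo m - unit_expo a = \<alpha> - unit_expo a + unit_expo m"
        using that by (intro add_minus_unit) auto
      moreover have "insert a A - {m} = insert a (A - {m})" using a by auto
      moreover have "sg m (insert a A) = (sg m A :: 'k)" using a by (intro sg_cong) auto
      ultimately show ?thesis by (simp add: sg_remove[OF True a] mult_ac)
    qed
    ultimately show ?thesis using True by (simp add: KT TK sum_negf)
  next
    case False
    have "kcontract V (kdiff V F) \<alpha> A = 0"
      using False by (simp add: kcontract_def flip: m_def)
    moreover have "kdiff V (kcontract V F) \<alpha> A = (\<Sum>a\<in>V \<inter> Poly_Mapping.keys \<alpha> - A. if a = m then F \<alpha> A else 0)"
      unfolding KT
    proof (rule sum.cong[OF refl])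
      fix a assume a: "a \<in> V \<inter> Poly_Mapping.keys \<alpha> - A"
      have "sg m A * sg m (insert m A) = (1::'k)"
        by (subst sg_cong[of m "insert m A" A]) (auto simp: sg_square)
      with a False show "sg a A * (if m \<in> insert a A then sg m (insert a A) *
          F (\<alpha> - unit_expo a + unit_expo m) (insert a A - {m}) else 0) = (if a = m then F \<alpha> A else 0)"
        by (auto simp: minus_add_unit mult.assoc[symmetric])
    qed
    ultimately show ?thesis using m False by simp
  qed
qed

lemma kcontract_eq_0:
  assumes "\<And>a. a \<in> A \<Longrightarrow> a \<in> V \<Longrightarrow> F (\<alpha> + unit_expo a) (A - {a}) = 0"
  shows "kcontract V F \<alpha> A = 0"
  using assms by (auto simp: kcontract_def Let_def)

section \<open>Coefficients of elements of \<open>\<And>F \<otimes> S(F)\<close>\<close>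

text \<open>With \<beta> fixed this is a family on which \<open>kos\<close> acts as
  \<open>kdiff\<close>; with \<alpha> fixed and \<beta> in the place of the monomial,
  \<open>kappa\<close> does.\<close>

definition ecoef :: "('n, 'k::field) exsym \<Rightarrow> 'n expo \<Rightarrow> 'n set \<Rightarrow> 'n expo \<Rightarrow> 'k" where
  "ecoef f \<alpha> A \<beta> = Poly_Mapping.lookup (Poly_Mapping.lookup f (A, \<beta>)) \<alpha>"

lemma ecoef_eqI: "(\<And>\<alpha> A \<beta>. ecoef f \<alpha> A \<beta> = ecoef g \<alpha> A \<beta>) \<Longrightarrow> f = g"
  by (auto simp: ecoef_def intro!: poly_mapping_eqI)

lemma ecoef_zero [simp]: "ecoef 0 \<alpha> A \<beta> = 0"
  and ecoef_add [simp]: "ecoef (f + g) \<alpha> A \<beta> = ecoef f \<alpha> A \<beta> + ecoef g \<alpha> A \<beta>"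
  and ecoef_minus [simp]: "ecoef (f - g) \<alpha> A \<beta> = ecoef f \<alpha> A \<beta> - ecoef g \<alpha> A \<beta>"
  and ecoef_uminus [simp]: "ecoef (- f) \<alpha> A \<beta> = - ecoef f \<alpha> A \<beta>"
  for f g :: "('n, 'k::field) exsym"
  by (simp_all add: ecoef_def lookup_add lookup_minus)

lemma in_exsym_part_iff:
  "f \<in> exsym_part a b \<longleftrightarrow> (\<forall>\<alpha> A \<beta>. ecoef f \<alpha> A \<beta> \<noteq> 0 \<longrightarrow> card A = a \<and> expo_deg \<beta> = b)"
proof -
  have "(\<exists>\<alpha>. ecoef f \<alpha> A \<beta> \<noteq> 0) \<longleftrightarrow> (A, \<beta>) \<in> Poly_Mapping.keys f" for A \<beta>
    by (metis ecoef_def in_keys_iff lookup_zero poly_mapping_eqI)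
  then show ?thesis unfolding exsym_part_def by fast
qed

lemma in_exsym_partD:
  assumes "f \<in> exsym_part a b" "ecoef f \<alpha> A \<beta> \<noteq> 0"
  shows "card A = a \<and> expo_deg \<beta> = b"
  using assms unfolding in_exsym_part_iff by blast

lemma finite_ecoef: "finite {(\<alpha>, A, \<beta>). ecoef f \<alpha> A \<beta> \<noteq> 0}"
proof (rule finite_subset)
  show "{(\<alpha>, A, \<beta>). ecoef f \<alpha> A \<beta> \<noteq> 0} \<subseteq> (\<Union>x\<in>Poly_Mapping.keys f.
      (\<lambda>\<alpha>. (\<alpha>, x)) ` Poly_Mapping.keys (Poly_Mapping.lookup f x))"
  proof safe
    fix \<alpha> A \<beta> assume "ecoef f \<alpha> A \<beta> \<noteq> 0"
    moreover from this have "Poly_Mapping.lookup f (A, \<beta>) \<noteq> 0" by (auto simp: ecoef_def)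
    ultimately show "(\<alpha>, A, \<beta>) \<in> (\<Union>x\<in>Poly_Mapping.keys f.
      (\<lambda>\<alpha>. (\<alpha>, x)) ` Poly_Mapping.keys (Poly_Mapping.lookup f x))"
      by (intro UN_I[of "(A, \<beta>)"] imageI) (simp_all add: ecoef_def in_keys_iff)
  qed
qed auto

text \<open>Contractions are defined on families of coefficients only; this turns their values back
  into module elements.\<close>

lemma ecoef_surj:
  assumes "finite {(\<alpha>, A, \<beta>). F \<alpha> A \<beta> \<noteq> (0::'k::field)}"
  shows "\<exists>f. ecoef f = F"
proof -
  have fin: "finite {\<alpha>. F \<alpha> A \<beta> \<noteq> 0}" for A \<beta>
    by (rule finite_subset[OF _ finite_imageI[OF assms, of fst]]) force
  define g where "g x = Abs_poly_mapping (\<lambda>\<alpha>. F \<alpha> (fst x) (snd x))" for x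
  have g: "Poly_Mapping.lookup (g x) \<alpha> = F \<alpha> (fst x) (snd x)" for x \<alpha>
    using fin by (simp add: g_def)
  have "{x. g x \<noteq> 0} \<subseteq> snd ` {(\<alpha>, A, \<beta>). F \<alpha> A \<beta> \<noteq> 0}"
  proof
    fix x assume "x \<in> {x. g x \<noteq> 0}"
    then obtain \<alpha> where "Poly_Mapping.lookup (g x) \<alpha> \<noteq> 0"
      by (metis lookup_zero mem_Collect_eq poly_mapping_eqI)
    then show "x \<in> snd ` {(\<alpha>, A, \<beta>). F \<alpha> A \<beta> \<noteq> 0}"
      by (cases x) (force simp: g)
  qed
  then have "finite {x. g x \<noteq> 0}" using assms finite_subset by blast
  then have "ecoef (Abs_poly_mapping g) = F"
    by (intro ext) (simp add: ecoef_def g)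
  then show ?thesis by blast
qed

text \<open>Every nonzero coefficient of the contraction comes from one of F by moving a single
  index m, and there are finitely many m.\<close>

lemma finite_kcontract:
  fixes F :: "'n::{finite, linorder} expo \<Rightarrow> 'n set \<Rightarrow> 'b \<Rightarrow> 'k::field"
  assumes "finite {(\<alpha>, A, \<beta>). F \<alpha> A \<beta> \<noteq> 0}"
  shows "finite {(\<alpha>, A, \<beta>). kcontract V (\<lambda>\<alpha> A. F \<alpha> A \<beta>) \<alpha> A \<noteq> 0}"
proof (rule finite_subset)
  show "{(\<alpha>, A, \<beta>). kcontract V (\<lambda>\<alpha> A. F \<alpha> A \<beta>) \<alpha> A \<noteq> 0} \<subseteq>
    (\<Union>m. (\<lambda>(\<alpha>, A, \<beta>). (\<alpha> - unit_expo m, insert m A, \<beta>)) ` {(\<alpha>, A, \<beta>). F \<alpha> A \<beta> \<noteq> 0})"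
  proof safe
    fix \<alpha> A \<beta> assume "kcontract V (\<lambda>\<alpha> A. F \<alpha> A \<beta>) \<alpha> A \<noteq> 0"
    then obtain m where m: "m \<in> A" "F (\<alpha> + unit_expo m) (A - {m}) \<beta> \<noteq> 0"
      using kcontract_eq_0[of A V "\<lambda>\<alpha> A. F \<alpha> A \<beta>" \<alpha>] by blast
    then show "(\<alpha>, A, \<beta>) \<in> (\<Union>m. (\<lambda>(\<alpha>, A, \<beta>). (\<alpha> - unit_expo m, insert m A, \<beta>)) ` {(\<alpha>, A, \<beta>). F \<alpha> A \<beta> \<noteq> 0})"
      by (intro UN_I[of m] image_eqI[of _ _ "(\<alpha> + unit_expo m, A - {m}, \<beta>)"]) auto
  qed
qed (use assms in auto)

section \<open>Both differentials computed on coefficients\<close>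

lemma exsym_decomp:
  "f = (\<Sum>x\<in>Poly_Mapping.keys f. exsym_scale (Poly_Mapping.lookup f x) (exsym_basis (fst x) (snd x)))"
  by (rule poly_mapping_eqI)
     (auto simp: lookup_sum exsym_basis_def lookup_single when_def in_keys_iff if_distrib sum.delta cong: if_cong)

lemma exsym_induct [case_names add scale]:
  fixes f :: "('n, 'k::field) exsym"
  assumes "\<And>f g. P f \<Longrightarrow> P g \<Longrightarrow> P (f + g)" and scale: "\<And>c A \<beta>. P (exsym_scale c (exsym_basis A \<beta>))"
  shows "P f"
proof -
  have "P (\<Sum>x\<in>S. exsym_scale (Poly_Mapping.lookup f x) (exsym_basis (fst x) (snd x)))"
    if "finite S" for S
    using that
  proof induction
    case empty
    show ?case using scale[of 0] by simp
  qed (simp add: assms)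
  then show ?thesis by (subst exsym_decomp) simp
qed

interpretation kos: module_hom exsym_scale exsym_scale kos
  unfolding kos_def by (rule module_hom_exsym_extend) (rule module_exsym_scale)

lemma kos_basis:
  "kos (exsym_basis A \<beta>) = (\<Sum>a\<in>A. exsym_scale (sgn_in a A * var a) (exsym_basis (A - {a}) \<beta>))"
  by (simp add: kos_def module_exsym_scale)

lemma lookup_sgn_in: "Poly_Mapping.lookup (sgn_in a A * p) \<alpha> = sg a A * Poly_Mapping.lookup p \<alpha>"
  by (simp add: sgn_in_def sg_def minus_one_power_iff)

lemma poly_induct [case_names add single]:
  fixes p :: "'a \<Rightarrow>\<^sub>0 'b::comm_monoid_add"
  assumes "\<And>p q. P p \<Longrightarrow> P q \<Longrightarrow> P (p + q)" and single: "\<And>a c. P (Poly_Mapping.single a c)"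
  shows "P p"
proof -
  have p: "p = (\<Sum>a\<in>Poly_Mapping.keys p. Poly_Mapping.single a (Poly_Mapping.lookup p a))"
    by (rule poly_mapping_eqI) (auto simp: lookup_sum lookup_single when_def in_keys_iff)
  have "P (\<Sum>a\<in>S. Poly_Mapping.single a (Poly_Mapping.lookup p a))" if "finite S" for S
    using that
  proof induction
    case empty
    show ?case using single[of undefined 0] by simp
  qed (simp add: assms)
  then show ?thesis by (subst p) simp
qed

lemma lookup_var_times:
  "Poly_Mapping.lookup (var a * p) \<alpha> =
     (if a \<in> Poly_Mapping.keys \<alpha> then Poly_Mapping.lookup p (\<alpha> - unit_expo a) else 0)"
proof (induction p rule: poly_induct)
  case (add p q)
  then show ?case by (simp add: distrib_left lookup_add)
next
  case (single \<gamma> c)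
  have "unit_expo a + \<gamma> = \<alpha> \<longleftrightarrow> a \<in> Poly_Mapping.keys \<alpha> \<and> \<gamma> = \<alpha> - unit_expo a"
    using keys_add_unit[of \<gamma> a] minus_add_unit[of a \<alpha>] by (auto simp: add.commute)
  then show ?case by (simp add: monomial_def mult_single lookup_single when_def)
qed

lemma lookup_kos:
  fixes f :: "('n::{finite, linorder}, 'k::field) exsym"
  shows "Poly_Mapping.lookup (kos f) (A, \<beta>) =
    (\<Sum>a\<in>-A. sgn_in a A * (var a * Poly_Mapping.lookup f (insert a A, \<beta>)))"
proof (induction f rule: exsym_induct)
  case (add f g)
  then show ?case by (simp add: kos.add lookup_add distrib_left sum.distrib)
next
  case (scale c A' \<beta>')
  have s: "sgn_in a (insert a A) = (sgn_in a A :: ('n, 'k) mpoly)" for a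
    by (auto simp: sgn_in_def intro!: arg_cong[where f = card] arg_cong[where f = "(^) _"])
  have "Poly_Mapping.lookup (kos (exsym_scale c (exsym_basis A' \<beta>'))) (A, \<beta>) =
      (\<Sum>a\<in>A'. c * (sgn_in a A' * (var a * (1 when (A' - {a}, \<beta>') = (A, \<beta>)))))"
    unfolding kos.scale kos_basis
    by (simp add: lookup_sum exsym_basis_def lookup_single mult.assoc sum_distrib_left)
  also have "\<dots> = (\<Sum>a\<in>-A. sgn_in a A * (var a * (c * (1 when (A', \<beta>') = (insert a A, \<beta>)))))"
  \<comment> \<open>Each sum has at most one nonzero term, at the a with
    \<open>A' = insert a A\<close>, and this a lies in both index sets.\<close>
  proof (rule sum.mono_neutral_cong)
    fix a assume "a \<in> A' \<inter> - A"
    then show "c * (sgn_in a A' * (var a * (1 when (A' - {a}, \<beta>') = (A, \<beta>)))) =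
      sgn_in a A * (var a * (c * (1 when (A', \<beta>') = (insert a A, \<beta>))))"
      by (cases "A' = insert a A") (auto simp: s mult_ac when_def)
  qed (auto simp: when_def)
  finally show ?case by (simp add: exsym_basis_def lookup_single)
qed

lemma ecoef_kos:
  fixes f :: "('n::{finite, linorder}, 'k::field) exsym"
  shows "ecoef (kos f) \<alpha> A \<beta> = kdiff UNIV (\<lambda>\<alpha> A. ecoef f \<alpha> A \<beta>) \<alpha> A"
proof -
  have "ecoef (kos f) \<alpha> A \<beta> = (\<Sum>a\<in>-A. if a \<in> Poly_Mapping.keys \<alpha>
      then sg a A * ecoef f (\<alpha> - unit_expo a) (insert a A) \<beta> else 0)"
    by (auto simp: ecoef_def lookup_kos lookup_sum lookup_sgn_in lookup_var_times intro!: sum.cong)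
  also have "\<dots> = kdiff UNIV (\<lambda>\<alpha> A. ecoef f \<alpha> A \<beta>) \<alpha> A"
    unfolding kdiff_def by (rule sum.mono_neutral_cong_right) auto
  finally show ?thesis .
qed

lemma lookup_kappa:
  fixes f :: "('n::{finite, linorder}, 'k::field) exsym"
  shows "Poly_Mapping.lookup (kappa f) (A, \<beta>) =
    (\<Sum>a\<in>Poly_Mapping.keys \<beta> - A. sgn_in a A * Poly_Mapping.lookup f (insert a A, \<beta> - unit_expo a))"
proof (induction f rule: exsym_induct)
  case (add f g)
  then show ?case by (simp add: kappa.add lookup_add distrib_left sum.distrib)
next
  case (scale c A' \<beta>')
  have s: "sgn_in a (insert a A) = (sgn_in a A :: ('n, 'k) mpoly)" for a
    by (auto simp: sgn_in_def intro!: arg_cong[where f = card] arg_cong[where f = "(^) _"])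
  have eq: "unit_expo a + \<beta>' = \<beta> \<longleftrightarrow> a \<in> Poly_Mapping.keys \<beta> \<and> \<beta>' = \<beta> - unit_expo a" for a
    using keys_add_unit[of \<beta>' a] minus_add_unit[of a \<beta>] by (auto simp: add.commute)
  have "Poly_Mapping.lookup (kappa (exsym_scale c (exsym_basis A' \<beta>'))) (A, \<beta>) =
      (\<Sum>a\<in>A'. c * (sgn_in a A' * (1 when (A' - {a}, unit_expo a + \<beta>') = (A, \<beta>))))"
    unfolding kappa.scale kappa_basis kappa_symbol_def
    by (simp add: lookup_sum exsym_basis_def lookup_single sum_distrib_left)
  also have "\<dots> = (\<Sum>a\<in>Poly_Mapping.keys \<beta> - A. sgn_in a A * (c * (1 when (A', \<beta>') = (insert a A, \<beta> - unit_expo a))))"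
  proof (rule sum.mono_neutral_cong)
    fix a assume "a \<in> A' \<inter> (Poly_Mapping.keys \<beta> - A)"
    then have "(A' - {a}, unit_expo a + \<beta>') = (A, \<beta>) \<longleftrightarrow> (A', \<beta>') = (insert a A, \<beta> - unit_expo a)"
      unfolding prod.inject eq by blast
    then show "c * (sgn_in a A' * (1 when (A' - {a}, unit_expo a + \<beta>') = (A, \<beta>))) =
      sgn_in a A * (c * (1 when (A', \<beta>') = (insert a A, \<beta> - unit_expo a)))"
      by (simp only:) (simp add: when_def s mult_ac)
  next
    fix a assume "a \<in> A' - (Poly_Mapping.keys \<beta> - A)"
    then have "(A' - {a}, unit_expo a + \<beta>') \<noteq> (A, \<beta>)" unfolding prod.inject eq by blast
    then show "c * (sgn_in a A' * (1 when (A' - {a}, unit_expo a + \<beta>') = (A, \<beta>))) = 0" by (simp only: when_def) simp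
  qed (auto simp: when_def)
  finally show ?case by (simp add: exsym_basis_def lookup_single)
qed

text \<open>The operator is the one for \<open>kos\<close>, with \<alpha> and \<beta> exchanging
  roles, so every fact about \<open>kdiff\<close> and its contraction serves both maps.\<close>

lemma ecoef_kappa:
  fixes f :: "('n::{finite, linorder}, 'k::field) exsym"
  shows "ecoef (kappa f) \<alpha> A \<beta> = kdiff UNIV (\<lambda>\<beta> A. ecoef f \<alpha> A \<beta>) \<beta> A"
  by (simp add: ecoef_def kdiff_def lookup_kappa lookup_sum lookup_sgn_in)

section \<open>Exactness of the complexes \<open>L\<^sub>d\<close>\<close>

lemma kcontract_nonzeroE:
  fixes V A :: "'n::{finite, linorder} set"
  assumes "kcontract V F \<alpha> A \<noteq> 0"
  obtains m where "m \<in> A" "m \<in> V" "\<And>b. b \<in> (A \<union> Poly_Mapping.keys \<alpha>) \<inter> V \<Longrightarrow> m \<le> b"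
    "F (\<alpha> + unit_expo m) (A - {m}) \<noteq> 0"
  using assms by (intro that[of "Min ((A \<union> Poly_Mapping.keys \<alpha>) \<inter> V)"])
    (auto simp: kcontract_def Let_def split: if_splits)

lemma in_exsym_part_removeD:
  fixes f :: "('n::{finite, linorder}, 'k::field) exsym"
  assumes "f \<in> exsym_part a b" "ecoef f \<alpha> (A - {m}) \<beta> \<noteq> 0" "m \<in> A"
  shows "card A = Suc a \<and> expo_deg \<beta> = b"
  using in_exsym_partD[OF assms(1,2)] assms(3) by (metis card_Suc_Diff1 finite)

lemma kdiff_nonzeroE:
  assumes "kdiff V F \<alpha> A \<noteq> 0"
  obtains a where "a \<in> V" "a \<in> Poly_Mapping.keys \<alpha>" "a \<notin> A" "F (\<alpha> - unit_expo a) (insert a A) \<noteq> 0"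
proof -
  obtain a where "a \<in> V \<inter> Poly_Mapping.keys \<alpha> - A" "sg a A * F (\<alpha> - unit_expo a) (insert a A) \<noteq> 0"
    using assms unfolding kdiff_def by (metis (no_types, lifting) sum.neutral)
  then show ?thesis by (intro that[of a]) auto
qed

text \<open>Inserting the smaller index flips the sign of the larger one, while inserting the larger
  does not affect the smaller.\<close>

lemma sg_swap:
  fixes A :: "'n::{finite, linorder} set"
  assumes "a \<notin> A" "b \<notin> A" "a \<noteq> b"
  shows "sg a A * sg b (insert a A) = - (sg b A * sg a (insert b A) :: 'k::field)"
  using assms
proof (induction a b rule: linorder_wlog)
  case (le a b)
  then have "sg b (insert a A) = - (sg b (insert a A - {a}) :: 'k)"
    by (intro sg_remove) auto
  moreover have "sg a (insert b A) = (sg a A :: 'k)"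
    using le by (intro sg_cong) auto
  ultimately show ?case using le by simp
next
  case (sym a b)
  then show ?case by simp
qed

text \<open>The diagonal is left out, so the halves above and below it cancel without any division
  by 2.\<close>

lemma sum_skew_eq_0:
  fixes t :: "'a::linorder \<Rightarrow> 'a \<Rightarrow> 'b::ab_group_add"
  assumes "finite X" and skew: "\<And>a b. a \<in> X \<Longrightarrow> b \<in> X \<Longrightarrow> a < b \<Longrightarrow> t b a = - t a b"
  shows "(\<Sum>a\<in>X. \<Sum>b\<in>X - {a}. t a b) = 0"
proof -
  have "(\<Sum>b\<in>X - {a}. t a b) = (\<Sum>b\<in>{b \<in> X. a < b}. t a b) + (\<Sum>b\<in>{b \<in> X. b < a}. t a b)" for a
    by (subst sum.union_disjoint[symmetric]) (use assms in \<open>auto intro!: sum.cong\<close>)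
  moreover have "(\<Sum>a\<in>X. \<Sum>b\<in>{b \<in> X. b < a}. t a b) = (\<Sum>b\<in>X. \<Sum>a\<in>{a \<in> X. b < a}. t a b)"
    by (rule sum.swap_restrict[OF assms(1) assms(1)])
  moreover have "\<dots> = (\<Sum>b\<in>X. \<Sum>a\<in>{a \<in> X. b < a}. - t b a)"
    by (intro sum.cong refl) (auto simp: skew)
  ultimately show ?thesis by (simp add: sum.distrib sum_negf)
qed

lemma kdiff_kdiff:
  fixes A :: "'n::{finite, linorder} set" and F :: "'n expo \<Rightarrow> 'n set \<Rightarrow> 'k::field"
  shows "kdiff V (kdiff V F) \<alpha> A = 0"
proof -
  define X where "X = V \<inter> Poly_Mapping.keys \<alpha> - A"
  define t where "t a b = sg a A * sg b (insert a A) * F (\<alpha> - unit_expo a - unit_expo b) (insert b (insert a A))" for a b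
  have "kdiff V F (\<alpha> - unit_expo a) (insert a A) =
      (\<Sum>b\<in>X - {a}. sg b (insert a A) * F (\<alpha> - unit_expo a - unit_expo b) (insert b (insert a A)))"
    if "a \<in> X" for a
  proof -
    \<comment> \<open>Even if a still divides the monomial, it now lies in the exterior set and is
      skipped.\<close>
    have "V \<inter> Poly_Mapping.keys (\<alpha> - unit_expo a) - insert a A = X - {a}"
      using keys_minus_unit[of a \<alpha>] that by (auto simp: X_def)
    then show ?thesis by (simp add: kdiff_def)
  qed
  then have "kdiff V (kdiff V F) \<alpha> A = (\<Sum>a\<in>X. \<Sum>b\<in>X - {a}. t a b)"
    by (subst kdiff_def) (simp add: t_def sum_distrib_left mult.assoc flip: X_def)
  also have "\<dots> = 0"
  proof (rule sum_skew_eq_0)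
    fix a b assume "a \<in> X" "b \<in> X" "a < b"
    then have "sg b A * sg a (insert b A) = - (sg a A * sg b (insert a A) :: 'k)"
      by (intro sg_swap) (auto simp: X_def)
    then show "t b a = - t a b"
      by (simp add: t_def insert_commute diff_right_commute)
  qed simp
  finally show ?thesis .
qed

lemma kos_kos: "kos (kos f) = 0"
  for f :: "('n::{finite, linorder}, 'k::field) exsym"
  by (rule ecoef_eqI) (simp add: ecoef_kos kdiff_kdiff)

lemma kappa_kappa: "kappa (kappa f) = 0"
  for f :: "('n::{finite, linorder}, 'k::field) exsym"
  by (rule ecoef_eqI) (simp add: ecoef_kappa kdiff_kdiff)

text \<open>Each map takes an index out of the exterior factor, a for a factor x_a and b for a
  factor e_b. Both orders run over the same pairs a \<noteq> b, with opposite signs by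
  \<open>sg_swap\<close>.\<close>

lemma kos_kappa: "kos (kappa f) = - kappa (kos f)"
  for f :: "('n::{finite, linorder}, 'k::field) exsym"
proof (rule ecoef_eqI)
  fix \<alpha> \<beta> :: "'n expo" and A
  define X where "X = Poly_Mapping.keys \<alpha> - A"
  define Y where "Y = Poly_Mapping.keys \<beta> - A"
  define F where "F a b = ecoef f (\<alpha> - unit_expo a) (insert b (insert a A)) (\<beta> - unit_expo b)" for a b
  \<comment> \<open>Written as a set comprehension, the inner index set has the shape that
    \<open>sum.swap_restrict\<close> expects.\<close>
  have D: "Poly_Mapping.keys \<gamma> - insert a A = {b \<in> Poly_Mapping.keys \<gamma> - A. b \<noteq> a}" for a and \<gamma> :: "'n expo"
    by auto
  have "ecoef (kos (kappa f)) \<alpha> A \<beta> =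
      (\<Sum>a\<in>X. \<Sum>b\<in>{b \<in> Y. b \<noteq> a}. sg a A * sg b (insert a A) * F a b)"
    by (simp add: ecoef_kos ecoef_kappa kdiff_def D sum_distrib_left mult.assoc F_def flip: X_def Y_def)
  also have "\<dots> = (\<Sum>b\<in>Y. \<Sum>a\<in>{a \<in> X. b \<noteq> a}. sg a A * sg b (insert a A) * F a b)"
    by (rule sum.swap_restrict) (simp_all add: X_def Y_def)
  also have "\<dots> = (\<Sum>b\<in>Y. \<Sum>a\<in>{a \<in> X. b \<noteq> a}. - (sg b A * (sg a (insert b A) * F a b)))"
  proof (intro sum.cong refl)
    fix a b assume "b \<in> Y" "a \<in> {a \<in> X. b \<noteq> a}"
    then have "sg a A * sg b (insert a A) = - (sg b A * sg a (insert b A) :: 'k)"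
      by (intro sg_swap) (auto simp: X_def Y_def)
    then show "sg a A * sg b (insert a A) * F a b = - (sg b A * (sg a (insert b A) * F a b))"
      by (simp add: mult.assoc)
  qed
  also have "\<dots> = ecoef (- kappa (kos f)) \<alpha> A \<beta>"
    by (simp add: ecoef_kos ecoef_kappa kdiff_def D sum_distrib_left sum_negf F_def insert_commute
          eq_commute[of _ "_ :: 'n"] flip: X_def Y_def)
  finally show "ecoef (kos (kappa f)) \<alpha> A \<beta> = ecoef (- kappa (kos f)) \<alpha> A \<beta>" .
qed

lemma expo_deg_minus_unit: "a \<in> Poly_Mapping.keys \<alpha> \<Longrightarrow> expo_deg \<alpha> = Suc (expo_deg (\<alpha> - unit_expo a))"
  for \<alpha> :: "'n expo"
  by (metis Suc_eq_plus1 expo_deg_add expo_deg_single minus_add_unit)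

lemma kos_in_exsym_part:
  fixes f :: "('n::{finite, linorder}, 'k::field) exsym"
  assumes "f \<in> exsym_part (Suc i) b"
  shows "kos f \<in> exsym_part i b"
  unfolding in_exsym_part_iff ecoef_kos
  using assms by (auto dest!: in_exsym_partD elim!: kdiff_nonzeroE)

lemma kappa_in_exsym_part:
  fixes f :: "('n::{finite, linorder}, 'k::field) exsym"
  assumes "f \<in> exsym_part (Suc i) b"
  shows "kappa f \<in> exsym_part i (Suc b)"
  unfolding in_exsym_part_iff ecoef_kappa
  using assms by (auto simp: expo_deg_minus_unit dest!: in_exsym_partD elim!: kdiff_nonzeroE)

lemma kos_exact:
  fixes f :: "('n::{finite, linorder}, 'k::field) exsym"
  assumes f: "f \<in> exsym_part i b" and "1 \<le> i" and "kos f = 0"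
  obtains g where "g \<in> exsym_part (Suc i) b" "kos g = f"
proof -
  define F where "F \<alpha> A \<beta> = kcontract UNIV (\<lambda>\<alpha> A. ecoef f \<alpha> A \<beta>) \<alpha> A" for \<alpha> A \<beta>
  have "finite {(\<alpha>, A, \<beta>). F \<alpha> A \<beta> \<noteq> 0}"
    unfolding F_def using finite_ecoef by (rule finite_kcontract)
  then obtain g where g: "ecoef g = F" using ecoef_surj by blast
  show thesis
  proof (rule that)
    show "g \<in> exsym_part (Suc i) b"
      unfolding in_exsym_part_iff g F_def
      by (auto dest!: in_exsym_part_removeD[OF f] elim!: kcontract_nonzeroE)
    show "kos g = f"
    proof (rule ecoef_eqI)
      fix \<alpha> A \<beta>
      have "kcontract UNIV (kdiff UNIV (\<lambda>\<alpha> A. ecoef f \<alpha> A \<beta>)) \<alpha> A = 0"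
        by (rule kcontract_eq_0) (simp add: \<open>kos f = 0\<close> flip: ecoef_kos)
      then show "ecoef (kos g) \<alpha> A \<beta> = ecoef f \<alpha> A \<beta>"
        using kdiff_kcontract[of A \<alpha> UNIV "\<lambda>\<alpha> A. ecoef f \<alpha> A \<beta>"] f \<open>1 \<le> i\<close>
        by (cases "A \<union> Poly_Mapping.keys \<alpha> = {}")
           (auto simp: ecoef_kos g F_def kdiff_def dest: in_exsym_partD)
    qed
  qed
qed

text \<open>The last property says that \<open>g\<close> involves standard symbols only.\<close>

lemma kappa_exact:
  fixes f :: "('n::{finite, linorder}, 'k::field) exsym"
  assumes f: "f \<in> exsym_part i b" and ib: "1 \<le> i \<or> 1 \<le> b" and "kappa f = 0"
  obtains g where "g \<in> exsym_part (Suc i) (b - 1)" "kappa g = f"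
    "\<And>\<alpha> A \<beta>. ecoef g \<alpha> A \<beta> \<noteq> 0 \<Longrightarrow> \<exists>m\<in>A. (\<forall>c\<in>A \<union> Poly_Mapping.keys \<beta>. m \<le> c) \<and>
       ecoef f \<alpha> (A - {m}) (\<beta> + unit_expo m) \<noteq> 0"
proof -
  define F where "F \<alpha> A \<beta> = kcontract UNIV (\<lambda>\<beta> A. ecoef f \<alpha> A \<beta>) \<beta> A" for \<alpha> A \<beta>
  \<comment> \<open>\<open>finite_kcontract\<close> contracts in the first argument, so \<alpha> and
    \<beta> are exchanged and afterwards exchanged back.\<close>
  have "{(\<beta>, A, \<alpha>). ecoef f \<alpha> A \<beta> \<noteq> 0} = (\<lambda>(\<alpha>, A, \<beta>). (\<beta>, A, \<alpha>)) ` {(\<alpha>, A, \<beta>). ecoef f \<alpha> A \<beta> \<noteq> 0}"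
    by force
  then have "finite {(\<beta>, A, \<alpha>). ecoef f \<alpha> A \<beta> \<noteq> 0}"
    using finite_ecoef[of f] by simp
  then have "finite {(\<beta>, A, \<alpha>). F \<alpha> A \<beta> \<noteq> 0}"
    unfolding F_def by (rule finite_kcontract)
  moreover have "{(\<alpha>, A, \<beta>). F \<alpha> A \<beta> \<noteq> 0} = (\<lambda>(\<alpha>, A, \<beta>). (\<beta>, A, \<alpha>)) ` {(\<beta>, A, \<alpha>). F \<alpha> A \<beta> \<noteq> 0}"
    by force
  ultimately have "finite {(\<alpha>, A, \<beta>). F \<alpha> A \<beta> \<noteq> 0}" by simp
  then obtain g where g: "ecoef g = F" using ecoef_surj by blast
  \<comment> \<open>The coefficient of f that is read is recorded as well; it serves later to rule
    out excluded symbols.\<close>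
  have supp: "\<exists>m\<in>A. (\<forall>c\<in>A \<union> Poly_Mapping.keys \<beta>. m \<le> c) \<and>
       ecoef f \<alpha> (A - {m}) (\<beta> + unit_expo m) \<noteq> 0" if "ecoef g \<alpha> A \<beta> \<noteq> 0" for \<alpha> A \<beta>
    using that unfolding g F_def by (auto elim!: kcontract_nonzeroE)
  show thesis
  proof (rule that[OF _ _ supp])
    show "g \<in> exsym_part (Suc i) (b - 1)"
      unfolding in_exsym_part_iff
    proof (intro allI impI)
      fix \<alpha> A \<beta> assume "ecoef g \<alpha> A \<beta> \<noteq> 0"
      then obtain m where m: "m \<in> A" "ecoef f \<alpha> (A - {m}) (\<beta> + unit_expo m) \<noteq> 0"
        using supp by blast
      then show "card A = Suc i \<and> expo_deg \<beta> = b - 1"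
        using in_exsym_part_removeD[OF f m(2,1)] by (auto simp: expo_deg_add expo_deg_single)
    qed
    show "kappa g = f"
    proof (rule ecoef_eqI)
      fix \<alpha> A \<beta>
      have "kcontract UNIV (kdiff UNIV (\<lambda>\<beta> A. ecoef f \<alpha> A \<beta>)) \<beta> A = 0"
        by (rule kcontract_eq_0) (simp add: \<open>kappa f = 0\<close> flip: ecoef_kappa)
      \<comment> \<open>Where A and \<beta> are both empty, f has no coefficient, because one of its
        two degrees i and b is positive.\<close>
      then show "ecoef (kappa g) \<alpha> A \<beta> = ecoef f \<alpha> A \<beta>"
        using kdiff_kcontract[of A \<beta> UNIV "\<lambda>\<beta> A. ecoef f \<alpha> A \<beta>"] f ib
        by (cases "A \<union> Poly_Mapping.keys \<beta> = {}")
           (auto simp: ecoef_kappa g F_def kdiff_def expo_deg_def dest: in_exsym_partD)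
    qed
  qed
qed

text \<open>The preimage reads f only at exponents \<beta> + \<epsilon>_m of positive degree, where
  f vanishes. Its own degree does not show this, since \<open>0 - 1 = 0\<close> for natural
  numbers.\<close>

lemma kappa_inj_on_degree_0:
  fixes f :: "('n::{finite, linorder}, 'k::field) exsym"
  assumes f: "f \<in> exsym_part i 0" and "1 \<le> i" and "kappa f = 0"
  shows "f = 0"
proof -
  obtain g where g: "kappa g = f" "\<And>\<alpha> A \<beta>. ecoef g \<alpha> A \<beta> \<noteq> 0 \<Longrightarrow>
      \<exists>m\<in>A. (\<forall>c\<in>A \<union> Poly_Mapping.keys \<beta>. m \<le> c) \<and> ecoef f \<alpha> (A - {m}) (\<beta> + unit_expo m) \<noteq> 0"
    by (rule kappa_exact[OF f _ assms(3)]) (use assms(2) in auto)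
  have "ecoef g \<alpha> A \<beta> = 0" for \<alpha> A \<beta>
  proof (rule ccontr)
    assume "ecoef g \<alpha> A \<beta> \<noteq> 0"
    then obtain m where "ecoef f \<alpha> (A - {m}) (\<beta> + unit_expo m) \<noteq> 0" using g(2) by blast
    from in_exsym_partD[OF f this] show False by (simp add: expo_deg_add expo_deg_single)
  qed
  then have "g = 0" by (intro ecoef_eqI) simp
  with g show ?thesis by simp
qed

section \<open>The augmentation, and exactness by induction on the symmetric degree\<close>

lemma module_mult: "module ((*) :: 'a::comm_ring_1 \<Rightarrow> 'a \<Rightarrow> 'a)"
  by unfold_locales (simp_all add: distrib_left distrib_right mult.assoc)

interpretation sym_psi: module_hom exsym_scale "(*)" sym_psi
  unfolding sym_psi_def by (rule module_hom_exsym_extend) (rule module_mult)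

lemma sym_psi_basis: "sym_psi (exsym_basis A \<beta>) = monomial \<beta>"
  by (simp add: sym_psi_def module_mult)

text \<open>A factor x_a and a factor e_a have the same value under \<open>sym_psi\<close>, which
  ignores the exterior part. It follows that \<open>sym_psi\<close> kills
  \<open>kos (kappa u)\<close>, as it equals \<open>sym_psi (kappa (kappa u))\<close>.\<close>

lemma sym_psi_kos: "sym_psi (kos f) = sym_psi (kappa f)"
proof (induction f rule: exsym_induct)
  case (add f g)
  then show ?case by (simp add: kos.add kappa.add sym_psi.add)
next
  case (scale c A \<beta>)
  have *: "monomial (unit_expo a + \<beta>) = var a * monomial \<beta>" for a
    by (simp add: monomial_def mult_single)
  then show ?case
    unfolding kos.scale kappa.scale sym_psi.scale kos_basis kappa_basis kappa_symbol_def
      sym_psi.sum sym_psi.scale sym_psi_basis by (simp only: * mult.assoc)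
qed

text \<open>Write \<open>f = kappa u\<close>. Then \<open>kos u\<close> is a cycle of symmetric
  degree one less in the kernel of \<open>kappa\<close>, so by induction
  \<open>kos u = kos w\<close> with \<open>kappa w = 0\<close>, and \<open>u - w = kos y\<close>.
  Anticommutation gives \<open>kos (- kappa y) = kappa (u - w) = f\<close>.\<close>

lemma L_exact:
  fixes f :: "('n::{finite, linorder}, 'k::field) exsym"
  assumes "f \<in> exsym_part i d" "kappa f = 0" "kos f = 0" "i = 0 \<Longrightarrow> sym_psi f = 0"
  shows "\<exists>g\<in>exsym_part (Suc i) d. kappa g = 0 \<and> kos g = f"
  using assms
proof (induction d arbitrary: f)
  case 0
  \<comment> \<open>For i = 0 the module is R itself with \<open>sym_psi\<close> as the
    identification; for i > 0 \<open>kappa\<close> is injective in symmetric degree 0.\<close>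
  have "f = 0"
  proof (cases "i = 0")
    case True
    have 1: "Poly_Mapping.keys f \<subseteq> {({}, 0)}"
      using 0(1) True by (auto simp: exsym_part_def expo_deg_def in_keys_iff intro!: poly_mapping_eqI)
    then have "sym_psi f = Poly_Mapping.lookup f ({}, 0)"
      unfolding sym_psi_def
      by (subst exsym_extend_superset[OF module_mult, of "{({}, 0)}"]) (auto simp: monomial_def)
    with 0(4) True have "({}, 0) \<notin> Poly_Mapping.keys f" by (simp add: in_keys_iff)
    with 1 have "Poly_Mapping.keys f = {}" by blast
    then show ?thesis by simp
  qed (use 0 kappa_inj_on_degree_0[of f i] in auto)
  then show ?case using exsym.subspace_0[OF subspace_exsym_part] by (intro bexI[of _ 0]) auto
next
  case (Suc d)
  obtain u where u: "u \<in> exsym_part (Suc i) d" "kappa u = f"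
    by (rule kappa_exact[OF Suc.prems(1) _ Suc.prems(2)]) (auto simp: One_nat_def)
  \<comment> \<open>For i = 0 the induction hypothesis also asks that \<open>sym_psi\<close> kill
    \<open>kos u\<close>; its value there is that of \<open>kappa u\<close>, which is f.\<close>
  obtain w where w: "w \<in> exsym_part (Suc i) d" "kappa w = 0" "kos w = kos u"
  proof -
    have "kappa (kos u) = 0"
      using kos_kappa[of u] Suc.prems u by simp
    then show thesis
      using Suc.IH[of "kos u"] u Suc.prems that by (auto simp: kos_in_exsym_part kos_kos sym_psi_kos)
  qed
  obtain y where y: "y \<in> exsym_part (Suc (Suc i)) d" "kos y = u - w"
  proof (rule kos_exact)
    show "u - w \<in> exsym_part (Suc i) d"
      using u w by (simp add: exsym.subspace_diff[OF subspace_exsym_part])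
    show "kos (u - w) = 0" using w by (simp add: kos.diff)
  qed (auto intro: that)
  show ?case
  proof (intro bexI conjI)
    show "- kappa y \<in> exsym_part (Suc i) (Suc d)"
      by (intro exsym.subspace_neg[OF subspace_exsym_part] kappa_in_exsym_part y)
    show "kappa (- kappa y) = 0" by (simp add: kappa.neg kappa_kappa)
    show "kos (- kappa y) = f" using u w by (simp add: kos.neg kos_kappa y kappa.diff)
  qed
qed

section \<open>The subcomplex \<open>L\<^sub>d\<^sup>B\<close>\<close>

text \<open>The index i is that of the image under \<open>kappa\<close>; the elements themselves
  have exterior degree i + 1. Standardness is not demanded, as \<open>kos\<close> would not preserve
  it.\<close>

definition reduced :: "nat \<Rightarrow> 'n expo set \<Rightarrow> nat \<Rightarrow> ('n::linorder, 'k::field) exsym set" where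
  "reduced d B i = {u \<in> exsym_part (Suc i) (d - 1). \<forall>x\<in>excluded d B. Poly_Mapping.lookup u x = 0}"

lemma excluded_iff:
  "(A, \<beta>) \<in> excluded d B \<longleftrightarrow>
     (\<exists>k\<in>A. \<beta> = Poly_Mapping.single k (d - 1) \<and> Poly_Mapping.single k d \<in> B)"
proof
  assume "\<exists>k\<in>A. \<beta> = Poly_Mapping.single k (d - 1) \<and> Poly_Mapping.single k d \<in> B"
  then obtain k where "k \<in> A" "\<beta> = Poly_Mapping.single k (d - 1)" "Poly_Mapping.single k d \<in> B"
    by blast
  then show "(A, \<beta>) \<in> excluded d B"
    unfolding excluded_def by (intro CollectI exI[of _ k] exI[of _ "A - {k}"]) auto
qed (auto simp: excluded_def)

lemma lookup_eq_0_iff_ecoef: "Poly_Mapping.lookup u (A, \<beta>) = 0 \<longleftrightarrow> (\<forall>\<alpha>. ecoef u \<alpha> A \<beta> = 0)"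
  by (auto simp: ecoef_def intro: poly_mapping_eqI)

lemma in_reduced_iff:
  "u \<in> reduced d B i \<longleftrightarrow> u \<in> exsym_part (Suc i) (d - 1) \<and>
     (\<forall>k \<alpha> A. k \<in> A \<longrightarrow> Poly_Mapping.single k d \<in> B \<longrightarrow> ecoef u \<alpha> A (Poly_Mapping.single k (d - 1)) = 0)"
  unfolding reduced_def mem_Collect_eq Ball_def split_paired_All excluded_iff lookup_eq_0_iff_ecoef
  by blast

lemma subspace_reduced: "exsym.subspace (reduced d B i)"
  using subspace_exsym_part[of "Suc i" "d - 1"]
  by (auto simp: reduced_def exsym.subspace_def lookup_add)

text \<open>\<open>kos\<close> keeps \<beta> and shrinks A, and a symbol is excluded as soon as one
  with the same \<beta> and a smaller A is.\<close>

lemma kos_in_reduced: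
  fixes u :: "('n::{finite, linorder}, 'k::field) exsym"
  assumes "u \<in> reduced d B (Suc i)"
  shows "kos u \<in> reduced d B i"
  using assms kos_in_exsym_part[of u "Suc i" "d - 1"]
  by (auto simp: in_reduced_iff ecoef_kos kdiff_def)

text \<open>Rewriting \<open>kappa u\<close> in standard symbols by the contraction creates no
  excluded ones: at an excluded symbol the contraction can only return the coefficient of u at that
  same symbol, which is 0.\<close>

lemma LB_eq:
  assumes "1 \<le> d"
  shows "LB d B i = (kappa ` reduced d B i :: ('n::{finite, linorder}, 'k::field) exsym set)"
    (is "?LB = ?kR")
proof (rule antisym)
  show "?LB \<subseteq> ?kR"
    unfolding LB_def
  proof (rule exsym.span_minimal)
    show "exsym.subspace ?kR"
      using subspace_reduced by (rule kappa.subspace_image)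
    show "(\<lambda>(A, \<beta>). kappa (exsym_basis A \<beta>)) ` (standard d i - excluded d B) \<subseteq> ?kR"
      by (auto simp: standard_def reduced_def exsym_part_def exsym_basis_def lookup_single when_def
        intro!: imageI)
  qed
  show "?kR \<subseteq> ?LB"
  proof (rule image_subsetI)
    fix u :: "('n, 'k) exsym" assume u: "u \<in> reduced d B i"
    have "kappa u \<in> exsym_part i d"
      using kappa_in_exsym_part[of u i "d - 1"] u \<open>1 \<le> d\<close> by (simp add: in_reduced_iff)
    then obtain g where g: "g \<in> exsym_part (Suc i) (d - 1)" "kappa g = kappa u"
      and supp: "\<And>\<alpha> A \<beta>. ecoef g \<alpha> A \<beta> \<noteq> 0 \<Longrightarrow> \<exists>m\<in>A. (\<forall>c\<in>A \<union> Poly_Mapping.keys \<beta>. m \<le> c) \<and>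
       ecoef (kappa u) \<alpha> (A - {m}) (\<beta> + unit_expo m) \<noteq> 0"
      using \<open>1 \<le> d\<close> by (auto intro: kappa_exact[of "kappa u" i d] simp: kappa_kappa)
    have "x \<in> standard d i - excluded d B" if x: "x \<in> Poly_Mapping.keys g" for x
    proof -
      obtain A \<beta> where [simp]: "x = (A, \<beta>)" by (cases x)
      from x obtain \<alpha> where \<alpha>: "ecoef g \<alpha> A \<beta> \<noteq> 0"
        by (auto simp: in_keys_iff lookup_eq_0_iff_ecoef)
      have c: "card A = Suc i" "expo_deg \<beta> = d - 1"
        using g(1) \<alpha> by (auto dest: in_exsym_partD)
      obtain m where m: "m \<in> A" "\<And>c. c \<in> A \<union> Poly_Mapping.keys \<beta> \<Longrightarrow> m \<le> c"
        and nz: "ecoef (kappa u) \<alpha> (A - {m}) (\<beta> + unit_expo m) \<noteq> 0"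
        using supp[OF \<alpha>] by blast
      have "Min A = m" using m by (intro Min_eqI) auto
      moreover have "m \<le> Min (Poly_Mapping.keys \<beta>)" if "d \<noteq> 1"
      proof -
        have "Poly_Mapping.keys \<beta> \<noteq> {}"
          using that c \<open>1 \<le> d\<close> by (auto simp: expo_deg_def)
        then show ?thesis using m by (intro Min.boundedI) auto
      qed
      ultimately have "x \<in> standard d i"
        using c by (auto simp: standard_def)
      moreover have "x \<notin> excluded d B"
      proof
        assume "x \<in> excluded d B"
        then obtain k where k: "k \<in> A" "\<beta> = Poly_Mapping.single k (d - 1)" "Poly_Mapping.single k d \<in> B"
          by (auto simp: excluded_iff)
        obtain c where "c \<in> Poly_Mapping.keys (\<beta> + unit_expo m)" "c \<notin> A - {m}"
          and nz': "ecoef u \<alpha> (insert c (A - {m})) (\<beta> + unit_expo m - unit_expo c) \<noteq> 0"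
          using nz unfolding ecoef_kappa by (rule kdiff_nonzeroE)
        \<comment> \<open>Only k and m occur in \<beta> + \<epsilon>_m, and k lies in
          \<open>A - {m}\<close> unless it equals m.\<close>
        then have "c = m" using k by (auto simp: keys_add_unit split: if_splits)
        with nz' m have "ecoef u \<alpha> A \<beta> \<noteq> 0" by (simp add: insert_absorb)
        with u k show False by (auto simp: in_reduced_iff)
      qed
      ultimately show ?thesis by blast
    qed
    then have "kappa (\<Sum>x\<in>Poly_Mapping.keys g. exsym_scale (Poly_Mapping.lookup g x) (exsym_basis (fst x) (snd x)))
        \<in> LB d B i"
      unfolding kappa.sum kappa.scale LB_def
      by (intro exsym.span_sum exsym.span_scale exsym.span_base) (force simp: case_prod_beta)
    then show "kappa u \<in> LB d B i"
      using g exsym_decomp[of g] by simp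
  qed
qed

text \<open>\<open>L_exact\<close> gives a preimage \<open>kappa w\<close> of f. Replacing w by
  \<open>w - kos y\<close> does not change \<open>kos (kappa w)\<close>, and a suitable y removes
  all excluded symbols, so that \<open>LB_eq\<close> applies. By \<open>uniq\<close> the corrections
  for different k do not interfere.\<close>

lemma LB_exact:
  fixes f :: "('n::{finite, linorder}, 'k::field) exsym"
  assumes "1 \<le> d"
    and uniq: "\<And>k k'. Poly_Mapping.single k d \<in> B \<Longrightarrow> Poly_Mapping.single k' d \<in> B \<Longrightarrow>
        Poly_Mapping.single k (d - 1) = Poly_Mapping.single k' (d - 1) \<Longrightarrow> k = k'"
    and f: "f \<in> LB d B i" "kos f = 0" "i = 0 \<Longrightarrow> sym_psi f = 0"
  shows "f \<in> kos ` LB d B (Suc i)"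
proof -
  obtain u where u: "u \<in> reduced d B i" "kappa u = f"
    using f(1) unfolding LB_eq[OF \<open>1 \<le> d\<close>] by blast
  have fL: "f \<in> exsym_part i d" "kappa f = 0"
    using LB_subset_L[OF \<open>1 \<le> d\<close>] f(1) unfolding L_module_def by blast+
  obtain g where g: "g \<in> exsym_part (Suc i) d" "kappa g = 0" "kos g = f"
    using L_exact[of f i d] fL f by blast
  obtain w where w: "w \<in> exsym_part (Suc (Suc i)) (d - 1)" "kappa w = g"
    by (rule kappa_exact[OF g(1) _ g(2)]) auto
  \<comment> \<open>As \<open>kappa (kos w) = - kos g = - f\<close>, the element
    \<open>u + kos w\<close> is some \<open>kappa z\<close>. Such an element has no coefficient at
    an excluded symbol: \<beta> can only give up k, which A already contains. So the excluded part
    of w is a cycle.\<close>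
  have kw: "ecoef (kos w) \<alpha> A (Poly_Mapping.single k (d - 1)) = 0"
    if k: "k \<in> A" "Poly_Mapping.single k d \<in> B" for \<alpha> k A
  proof -
    have z: "u + kos w \<in> exsym_part (Suc i) (d - 1)"
      using u kos_in_exsym_part[OF w(1)]
      by (auto simp: in_reduced_iff intro: exsym.subspace_add[OF subspace_exsym_part])
    have "kappa (u + kos w) = 0"
      using kos_kappa[of w] by (simp add: kappa.add u w g)
    then obtain z where "kappa z = u + kos w"
      using kappa_exact[OF z] by (metis le_add1 plus_1_eq_Suc)
    then have "ecoef (u + kos w) \<alpha> A (Poly_Mapping.single k (d - 1)) =
        kdiff UNIV (\<lambda>\<beta> A. ecoef z \<alpha> A \<beta>) (Poly_Mapping.single k (d - 1)) A"
      by (metis ecoef_kappa)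
    also have "\<dots> = 0" using k by (auto simp: kdiff_def split: if_splits)
    finally show ?thesis using u k by (auto simp: in_reduced_iff)
  qed
  \<comment> \<open>Contract the part of \<open>w\<close> on the excluded symbols, using all variables except \<open>x\<^sub>k\<close>.\<close>
  define Y where "Y \<alpha> A \<beta> = (\<Sum>k\<in>{k \<in> A. \<beta> = Poly_Mapping.single k (d - 1) \<and> Poly_Mapping.single k d \<in> B}.
      kcontract (- {k}) (\<lambda>\<alpha> A. ecoef w \<alpha> A \<beta>) \<alpha> A)" for \<alpha> A \<beta>
  have Y_nz: "\<exists>k. kcontract (- {k}) (\<lambda>\<alpha> A. ecoef w \<alpha> A \<beta>) \<alpha> A \<noteq> 0" if "Y \<alpha> A \<beta> \<noteq> 0" for \<alpha> A \<beta>
    using that unfolding Y_def by (meson sum.neutral)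
  have "finite (\<Union>k. {(\<alpha>, A, \<beta>). kcontract (- {k}) (\<lambda>\<alpha> A. ecoef w \<alpha> A \<beta>) \<alpha> A \<noteq> 0})"
    using finite_kcontract[OF finite_ecoef[of w]] by auto
  then have "finite {(\<alpha>, A, \<beta>). Y \<alpha> A \<beta> \<noteq> 0}"
    by (rule finite_subset[rotated]) (auto dest!: Y_nz)
  then obtain y where y: "ecoef y = Y" using ecoef_surj by blast
  have y_part: "y \<in> exsym_part (Suc (Suc (Suc i))) (d - 1)"
    unfolding in_exsym_part_iff y
    by (auto dest!: Y_nz in_exsym_part_removeD[OF w(1)] elim!: kcontract_nonzeroE)
  have "w - kos y \<in> reduced d B (Suc i)"
    unfolding in_reduced_iff
  proof (intro conjI allI impI)
    show part: "w - kos y \<in> exsym_part (Suc (Suc i)) (d - 1)"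
      using w kos_in_exsym_part[OF y_part] by (simp add: exsym.subspace_diff[OF subspace_exsym_part])
    fix k \<alpha> A assume k: "k \<in> A" "Poly_Mapping.single k d \<in> B"
    define \<beta> where "\<beta> = Poly_Mapping.single k (d - 1)"
    define W where "W = (\<lambda>\<alpha> A. ecoef w \<alpha> A \<beta>)"
    \<comment> \<open>By \<open>uniq\<close> the sum that defines Y has k as its only index.\<close>
    have Yk: "Y \<alpha> A \<beta> = kcontract (- {k}) W \<alpha> A" if "k \<in> A" for \<alpha> A
    proof -
      have "{k \<in> A. \<beta> = Poly_Mapping.single k (d - 1) \<and> Poly_Mapping.single k d \<in> B} = {k}"
        using k uniq that by (auto simp: \<beta>_def)
      then show ?thesis by (simp add: Y_def W_def)
    qed
    \<comment> \<open>As k is in A, the differential in all variables skips it anyway.\<close>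
    have Vk: "kdiff UNIV F \<alpha> A = kdiff (- {k}) F \<alpha> A" if "k \<in> A" for F :: "'n expo \<Rightarrow> 'n set \<Rightarrow> 'k" and \<alpha> A
      unfolding kdiff_def by (rule sum.cong) (use that in auto)
    show "ecoef (w - kos y) \<alpha> A (Poly_Mapping.single k (d - 1)) = 0"
    proof (cases "card A = Suc (Suc i)")
      case False
      then show ?thesis using part unfolding in_exsym_part_iff by blast
    next
      case True
      \<comment> \<open>A has at least two elements, so an index other than k occurs and the
        homotopy identity for \<open>- {k}\<close> is available.\<close>
      have ne: "(A \<union> Poly_Mapping.keys \<alpha>) \<inter> - {k} \<noteq> {}"
      proof
        assume "(A \<union> Poly_Mapping.keys \<alpha>) \<inter> - {k} = {}"
        then have "A \<subseteq> {k}" by blast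
        then have "card A \<le> 1" using card_mono[of "{k}" A] by simp
        with True show False by simp
      qed
      have "ecoef (kos y) \<alpha> A \<beta> = kdiff UNIV (\<lambda>\<alpha> A. Y \<alpha> A \<beta>) \<alpha> A"
        by (simp add: ecoef_kos y)
      also have "\<dots> = kdiff (- {k}) (\<lambda>\<alpha> A. Y \<alpha> A \<beta>) \<alpha> A"
        by (rule Vk[OF k(1)])
      also have "\<dots> = kdiff (- {k}) (kcontract (- {k}) W) \<alpha> A"
        using k by (intro kdiff_cong) (simp add: Yk)
      also have "\<dots> = W \<alpha> A - kcontract (- {k}) (kdiff (- {k}) W) \<alpha> A"
        using kdiff_kcontract[OF ne, of W] by (simp add: eq_diff_eq)
      \<comment> \<open>This contraction never removes k, so it reads the differential only at sets
        containing k, where \<open>kw\<close> makes it 0.\<close>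
      also have "kcontract (- {k}) (kdiff (- {k}) W) \<alpha> A = 0"
      proof (rule kcontract_eq_0)
        fix a assume "a \<in> A" "a \<in> - {k}"
        then have "k \<in> A - {a}" using k by auto
        then show "kdiff (- {k}) W (\<alpha> + unit_expo a) (A - {a}) = 0"
          using kw[of k "A - {a}" "\<alpha> + unit_expo a"] k
          by (simp add: Vk[symmetric] W_def \<beta>_def flip: ecoef_kos)
      qed
      finally show ?thesis by (simp add: W_def \<beta>_def)
    qed
  qed
  then have "kappa (w - kos y) \<in> LB d B (Suc i)"
    unfolding LB_eq[OF \<open>1 \<le> d\<close>] by (rule imageI)
  \<comment> \<open>The correction \<open>kappa (kos y)\<close> equals
    \<open>- kos (kappa y)\<close>, which \<open>kos\<close> kills.\<close>
  moreover have "kos (kappa (w - kos y)) = f"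
    using kos_kappa[of y] w g by (simp add: kappa.diff kos.diff kos_kappa kos_kos kappa.neg kos.neg)
  ultimately show ?thesis by (metis imageI)
qed

section \<open>Grading, freeness and minimality\<close>

lemma in_exsym_homog_iff:
  "f \<in> exsym_homog j \<longleftrightarrow>
     (\<forall>\<alpha> A \<beta>. ecoef f \<alpha> A \<beta> \<noteq> 0 \<longrightarrow> expo_deg \<alpha> + card A + expo_deg \<beta> = j)"
proof -
  have "ecoef f \<alpha> A \<beta> \<noteq> 0 \<longleftrightarrow>
      (A, \<beta>) \<in> Poly_Mapping.keys f \<and> \<alpha> \<in> Poly_Mapping.keys (Poly_Mapping.lookup f (A, \<beta>))" for \<alpha> A \<beta>
    by (auto simp: ecoef_def in_keys_iff)
  then show ?thesis unfolding exsym_homog_def by blast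
qed

lemma in_exsym_homogD:
  "f \<in> exsym_homog j \<Longrightarrow> ecoef f \<alpha> A \<beta> \<noteq> 0 \<Longrightarrow> expo_deg \<alpha> + card A + expo_deg \<beta> = j"
  unfolding in_exsym_homog_iff by blast

lemma kos_in_exsym_homog:
  fixes f :: "('n::{finite, linorder}, 'k::field) exsym"
  assumes "f \<in> exsym_homog j"
  shows "kos f \<in> exsym_homog j"
  unfolding in_exsym_homog_iff ecoef_kos
  by (auto simp: expo_deg_minus_unit dest!: in_exsym_homogD[OF assms] elim!: kdiff_nonzeroE)

lemma kappa_in_exsym_homog:
  fixes f :: "('n::{finite, linorder}, 'k::field) exsym"
  assumes "f \<in> exsym_homog j"
  shows "kappa f \<in> exsym_homog j"
  unfolding in_exsym_homog_iff ecoef_kappa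
  by (auto simp: expo_deg_minus_unit dest!: in_exsym_homogD[OF assms] elim!: kdiff_nonzeroE)

lemma exsym_basis_in_homog: "exsym_basis A \<beta> \<in> exsym_homog (card A + expo_deg \<beta>)"
  by (auto simp: exsym_homog_def exsym_basis_def lookup_single when_def expo_deg_def)

lemma poly_homog_sum:
  fixes p :: "'i \<Rightarrow> ('n, 'k::field) mpoly"
  assumes "\<And>i. i \<in> I \<Longrightarrow> p i \<in> poly_homog j"
  shows "(\<Sum>i\<in>I. p i) \<in> poly_homog j"
proof -
  have "p + q \<in> poly_homog j" if "p \<in> poly_homog j" "q \<in> poly_homog j" for p q :: "('n, 'k) mpoly"
    using that Poly_Mapping.keys_add[of p q] unfolding poly_homog_def by blast
  moreover have "0 \<in> poly_homog j" by (simp add: poly_homog_def)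
  ultimately show ?thesis using assms by (induction I rule: infinite_finite_induct) auto
qed

text \<open>\<open>sym_psi\<close> forgets A together with its share \<open>card A\<close> of the
  degree, so exterior degree 0 is what makes it homogeneous.\<close>

lemma sym_psi_in_poly_homog:
  assumes part: "f \<in> exsym_part 0 d" and homog: "f \<in> exsym_homog j"
  shows "sym_psi f \<in> poly_homog j"
  unfolding sym_psi_def exsym_extend_def
proof (rule poly_homog_sum, clarify)
  fix A \<beta> assume x: "(A, \<beta>) \<in> Poly_Mapping.keys f"
  then have "card A = 0" using part by (auto simp: exsym_part_def)
  then have "expo_deg \<alpha> + expo_deg \<beta> = j" if "\<alpha> \<in> Poly_Mapping.keys (Poly_Mapping.lookup f (A, \<beta>))" for \<alpha>
    using in_exsym_homogD[OF homog, of \<alpha> A \<beta>] that by (simp add: ecoef_def in_keys_iff)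
  then show "Poly_Mapping.lookup f (A, \<beta>) * monomial \<beta> \<in> poly_homog j"
    using keys_mult[of "Poly_Mapping.lookup f (A, \<beta>)" "monomial \<beta>"]
    by (fastforce simp: poly_homog_def monomial_def expo_deg_add)
qed

section \<open>Finiteness and independence of the standard elements\<close>

lemma finite_expo_deg: "finite {\<beta> :: 'n::finite expo. expo_deg \<beta> = m}"
proof (induction m)
  case 0
  have "{\<beta> :: 'n expo. expo_deg \<beta> = 0} \<subseteq> {0}"
    by (auto simp: expo_deg_def in_keys_iff intro!: poly_mapping_eqI)
  then show ?case using finite_subset by blast
next
  case (Suc m)
  have "{\<beta> :: 'n expo. expo_deg \<beta> = Suc m} \<subseteq> (\<Union>a. (\<lambda>\<beta>. \<beta> + unit_expo a) ` {\<beta>. expo_deg \<beta> = m})"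
  proof clarify
    fix \<beta> :: "'n expo" assume *: "expo_deg \<beta> = Suc m"
    then have "Poly_Mapping.keys \<beta> \<noteq> {}" by (auto simp: expo_deg_def)
    then obtain a where a: "a \<in> Poly_Mapping.keys \<beta>" by blast
    show "\<beta> \<in> (\<Union>a. (\<lambda>\<beta>. \<beta> + unit_expo a) ` {\<beta>. expo_deg \<beta> = m})"
      using minus_add_unit[OF a] expo_deg_minus_unit[OF a] *
      by (intro UN_I[of a] image_eqI[of _ _ "\<beta> - unit_expo a"]) auto
  qed
  then show ?case by (rule finite_subset) (use Suc in auto)
qed

lemma finite_standard: "finite (standard d i :: ('n::{finite, linorder} set \<times> 'n expo) set)"
  by (rule finite_subset[of _ "UNIV \<times> {\<beta>. expo_deg \<beta> = d - 1}"])
     (auto simp: standard_def finite_expo_deg)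

text \<open>Standard basis elements are independent because each is detected by one coefficient.\<close>

lemma lookup_kappa_standard:
  fixes A A0 :: "'n::{finite, linorder} set"
  assumes x: "(A, \<beta>) \<in> standard d i" and x0: "(A0, \<beta>0) \<in> standard d i"
  shows "Poly_Mapping.lookup (kappa (exsym_basis A \<beta> :: ('n, 'k::field) exsym))
      (A0 - {Min A0}, \<beta>0 + unit_expo (Min A0)) = (if (A, \<beta>) = (A0, \<beta>0) then 1 else 0)"
proof -
  define m where "m = Min A0"
  have "A0 \<noteq> {}" "A \<noteq> {}" using x x0 by (auto simp: standard_def)
  then have m: "m \<in> A0" and min: "\<And>a. a \<in> A0 \<Longrightarrow> m \<le> a" by (auto simp: m_def)
  have ins: "insert m (A0 - {m}) = A0" using m by auto
  \<comment> \<open>A contribution with a \<noteq> m would come from a symbol whose A lies above m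
    while \<beta> contains m, which is not standard. For d = 1 no such a exists, since \<beta>0 is
    0.\<close>
  have other: "(A, \<beta>) \<noteq> (insert a (A0 - {m}), \<beta>0 + unit_expo m - unit_expo a)"
    if a: "a \<in> Poly_Mapping.keys (\<beta>0 + unit_expo m) - (A0 - {m})" "a \<noteq> m" for a
  proof
    assume *: "(A, \<beta>) = (insert a (A0 - {m}), \<beta>0 + unit_expo m - unit_expo a)"
    have a0: "a \<in> Poly_Mapping.keys \<beta>0" using a by (auto simp: keys_add_unit)
    then have d: "d \<noteq> 1" using x0 by (auto simp: standard_def expo_deg_def in_keys_iff)
    have "m \<le> Min (Poly_Mapping.keys \<beta>0)" using x0 d by (auto simp: standard_def m_def)
    then have "m \<le> a" using Min_le[OF finite_keys a0] by (rule order_trans)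
    then have "m < a" using a(2) by simp
    then have "m < c" if "c \<in> A" for c
      using that * min by (auto simp: order_le_less)
    then have "m < Min A" using \<open>A \<noteq> {}\<close> by simp
    moreover have "m \<in> Poly_Mapping.keys \<beta>"
      using * a(2) by (auto simp: in_keys_iff lookup_add lookup_minus lookup_single)
    then have "Min (Poly_Mapping.keys \<beta>) \<le> m" by simp
    moreover have "Min A \<le> Min (Poly_Mapping.keys \<beta>)" using x d by (auto simp: standard_def)
    ultimately show False by auto
  qed
  have "sgn_in m (A0 - {m}) = (1 :: ('n, 'k) mpoly)"
  proof -
    have "{b \<in> A0 - {m}. b < m} = {}" using min by (auto simp: not_less)
    then show ?thesis unfolding sgn_in_def by (simp only: card.empty power_0)
  qed
  then have "Poly_Mapping.lookup (kappa (exsym_basis A \<beta> :: ('n, 'k) exsym)) (A0 - {m}, \<beta>0 + unit_expo m) =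
      (\<Sum>a\<in>Poly_Mapping.keys (\<beta>0 + unit_expo m) - (A0 - {m}). if a = m then (if (A, \<beta>) = (A0, \<beta>0) then 1 else 0) else 0)"
    unfolding lookup_kappa
    by (intro sum.cong refl) (use other ins in \<open>auto simp: exsym_basis_def lookup_single when_def\<close>)
  also have "\<dots> = (if (A, \<beta>) = (A0, \<beta>0) then 1 else 0)"
    by (simp add: keys_add_unit)
  finally show ?thesis by (simp add: m_def)
qed

lemma standard_independent:
  "\<not> exsym.dependent ((\<lambda>(A, \<beta>). kappa (exsym_basis A \<beta> :: ('n::{finite, linorder}, 'k::field) exsym)) ` (standard d i - X))"
proof
  let ?g = "\<lambda>(A, \<beta>). kappa (exsym_basis A \<beta> :: ('n, 'k) exsym)"
  assume "exsym.dependent (?g ` (standard d i - X))"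
  then obtain T c v where T: "finite T" "T \<subseteq> ?g ` (standard d i - X)" "(\<Sum>v\<in>T. exsym_scale (c v) v) = 0"
    and v: "v \<in> T" "c v \<noteq> 0"
    unfolding exsym.dependent_explicit by blast
  then obtain A0 \<beta>0 where v0: "v = kappa (exsym_basis A0 \<beta>0)" "(A0, \<beta>0) \<in> standard d i" by auto
  let ?l = "(A0 - {Min A0}, \<beta>0 + unit_expo (Min A0))"
  \<comment> \<open>The same coefficient separates the images of different standard symbols, so
    working with the set of images loses nothing.\<close>
  have "Poly_Mapping.lookup w ?l = (if w = v then 1 else 0)" if w: "w \<in> T" for w
  proof -
    obtain A \<beta> where "w = kappa (exsym_basis A \<beta>)" "(A, \<beta>) \<in> standard d i" using T w by auto
    then show ?thesis
      using lookup_kappa_standard[of A \<beta> d i A0 \<beta>0, where 'k = 'k]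
        lookup_kappa_standard[of A0 \<beta>0 d i A0 \<beta>0, where 'k = 'k] v0
      by (cases "(A, \<beta>) = (A0, \<beta>0)") (simp_all, metis zero_neq_one)
  qed
  then have "Poly_Mapping.lookup (\<Sum>v\<in>T. exsym_scale (c v) v) ?l = (\<Sum>w\<in>T. if w = v then c w else 0)"
    unfolding lookup_sum by (intro sum.cong) auto
  with T v show False by simp
qed

lemma exsym_basis_in_reduced:
  "card A = Suc i \<Longrightarrow> expo_deg \<beta> = d - 1 \<Longrightarrow> (A, \<beta>) \<notin> excluded d B \<Longrightarrow> exsym_basis A \<beta> \<in> reduced d B i"
  by (auto simp: reduced_def exsym_part_def exsym_basis_def lookup_single when_def)

lemma graded_free_LB:
  assumes "1 \<le> d"
  shows "graded_free exsym_scale exsym_homog (LB d B i :: ('n::{finite, linorder}, 'k::field) exsym set)"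
  unfolding graded_free_def LB_def
proof (intro exI conjI)
  let ?g = "\<lambda>(A, \<beta>). kappa (exsym_basis A \<beta> :: ('n, 'k) exsym)"
  show "exsym.span (?g ` (standard d i - excluded d B)) = exsym.span (?g ` (standard d i - excluded d B))" ..
  show "exsym.independent (?g ` (standard d i - excluded d B))" by (rule standard_independent)
  show "finite (?g ` (standard d i - excluded d B))" using finite_standard by auto
  show "?g ` (standard d i - excluded d B) \<subseteq> (\<Union>j. exsym_homog j)"
    using kappa_in_exsym_homog[OF exsym_basis_in_homog] by fast
qed

section \<open>Minimality and the two ends of the complex\<close>

interpretation self: module "(*) :: 'a::comm_ring_1 \<Rightarrow> 'a \<Rightarrow> 'a"
  by (rule module_mult)

text \<open>Anticommutation gives a sum of terms x_a
  \<open>kappa (exsym_basis (A - {a}) \<beta>)\<close> up to sign. The symbols that remain need not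
  be standard, but they are not excluded, and \<open>LB_eq\<close> asks no more.\<close>

lemma kos_LB_minimal:
  assumes "1 \<le> d"
  shows "kos ` LB d B (Suc i) \<subseteq>
    irrelevant_mult exsym_scale (LB d B i :: ('n::{finite, linorder}, 'k::field) exsym set)"
  (is "_ \<subseteq> ?M")
proof -
  have "kos (kappa (exsym_basis A \<beta>)) \<in> ?M" if x: "(A, \<beta>) \<in> standard d (Suc i)" "(A, \<beta>) \<notin> excluded d B"
    for A :: "'n set" and \<beta>
  proof -
    have "exsym_scale (sgn_in a A * var a) (kappa (exsym_basis (A - {a}) \<beta>)) \<in> ?M" if a: "a \<in> A" for a
    proof -
      have "exsym_basis (A - {a}) \<beta> \<in> reduced d B i"
        using x a by (intro exsym_basis_in_reduced) (auto simp: standard_def excluded_iff One_nat_def)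
      then have "kappa (exsym_basis (A - {a}) \<beta>) \<in> (LB d B i :: ('n, 'k) exsym set)"
        unfolding LB_eq[OF assms] by (rule imageI)
      moreover have "sgn_in a A * var a \<in> (irrelevant_ideal :: ('n, 'k) mpoly set)"
        unfolding irrelevant_ideal_def by (intro self.span_scale self.span_base) auto
      ultimately show ?thesis
        unfolding irrelevant_mult_def by (intro exsym.span_base) auto
    qed
    moreover have "exsym.subspace ?M"
      unfolding irrelevant_mult_def by (rule exsym.subspace_span)
    ultimately have "- (\<Sum>a\<in>A. exsym_scale (sgn_in a A * var a) (kappa (exsym_basis (A - {a}) \<beta>))) \<in> ?M"
      by (intro exsym.subspace_neg exsym.subspace_sum)
    then show ?thesis
      unfolding kos_kappa kos_basis kappa.sum kappa.scale .
  qed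
  then show ?thesis
    unfolding LB_def[of d B "Suc i"] kos.span_image[symmetric]
    by (intro exsym.span_minimal) (auto simp: irrelevant_mult_def exsym.subspace_span)
qed

lemma kos_LB: "1 \<le> d \<Longrightarrow> kos ` LB d B (Suc i) \<subseteq> (LB d B i :: ('n::{finite, linorder}, 'k::field) exsym set)"
  by (auto simp: LB_eq kos_kappa kos_in_reduced simp flip: kappa.neg
      intro!: imageI exsym.subspace_neg[OF subspace_reduced])

text \<open>A symbol would need a set of more than n indices. This makes the left end of the complex
  like any other place.\<close>

lemma LB_eq_0:
  assumes "1 \<le> d" "CARD('n) \<le> i"
  shows "LB d B i = {0 :: ('n::{finite, linorder}, 'k::field) exsym}"
proof -
  have "u = 0" if "u \<in> reduced d B i" for u :: "('n, 'k) exsym"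
  proof (rule ecoef_eqI, rule ccontr)
    fix \<alpha> A \<beta> assume "ecoef u \<alpha> A \<beta> \<noteq> ecoef 0 \<alpha> A \<beta>"
    then have "card A = Suc i" using that by (auto simp: in_reduced_iff dest: in_exsym_partD)
    with assms(2) card_mono[of UNIV A] show False by simp
  qed
  moreover have "0 \<in> reduced d B i" using subspace_reduced by (rule exsym.subspace_0)
  ultimately have "reduced d B i = {0 :: ('n, 'k) exsym}" by blast
  then show ?thesis by (simp add: LB_eq[OF assms(1)])
qed

text \<open>The symbol of {a} and \<beta> has value x_a x^\<beta>, and this is a pure power x_k^d
  only if a = k and \<beta> = (d - 1) \<epsilon>_k, which is the shape of an excluded
  symbol.\<close>

lemma sym_psi_generators:
  fixes B :: "'n::{finite, linorder} expo set"
  assumes d: "1 \<le> d" and B: "\<And>\<gamma>. \<gamma> \<in> B \<Longrightarrow> \<exists>k. \<gamma> = Poly_Mapping.single k d"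
  shows "sym_psi ` (\<lambda>(A, \<beta>). kappa (exsym_basis A \<beta> :: ('n, 'k::field) exsym)) ` (standard d 0 - excluded d B)
    = monomial ` {\<gamma>. expo_deg \<gamma> = d \<and> \<gamma> \<notin> B}"
proof -
  have val: "sym_psi (kappa (exsym_basis {a} \<beta> :: ('n, 'k) exsym)) = monomial (unit_expo a + \<beta>)" for a \<beta>
  proof -
    have "{b \<in> {a}. b < a} = {}" by auto
    then have "sgn_in a {a} = (1 :: ('n, 'k) mpoly)" unfolding sgn_in_def by (simp only: card.empty power_0)
    then show ?thesis by (simp add: kappa_basis kappa_symbol_def sym_psi_basis)
  qed
  show ?thesis
  proof (intro antisym subsetI)
    fix p :: "('n, 'k) mpoly"
    assume "p \<in> sym_psi ` (\<lambda>(A, \<beta>). kappa (exsym_basis A \<beta> :: ('n, 'k) exsym)) ` (standard d 0 - excluded d B)"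
    then obtain A \<beta> where p: "p = sym_psi (kappa (exsym_basis A \<beta> :: ('n, 'k) exsym))"
      and x: "(A, \<beta>) \<in> standard d 0" "(A, \<beta>) \<notin> excluded d B" by auto
    obtain a where A: "A = {a}" using x by (auto simp: standard_def card_1_singleton_iff One_nat_def)
    have "unit_expo a + \<beta> \<notin> B"
    proof
      assume mem: "unit_expo a + \<beta> \<in> B"
      then obtain k where k: "unit_expo a + \<beta> = Poly_Mapping.single k d" using B by blast
      have "insert a (Poly_Mapping.keys \<beta>) = {k}"
        using k keys_add_unit[of \<beta> a] d by (simp add: add.commute)
      then have "a = k" by blast
      moreover have "\<beta> = Poly_Mapping.single k d - unit_expo a"
        using k by (metis add_diff_cancel_left')
      ultimately have "\<beta> = Poly_Mapping.single a (d - 1)" by (simp add: single_diff)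
      with x(2) k mem \<open>a = k\<close> show False by (auto simp: A excluded_iff)
    qed
    moreover have "expo_deg (unit_expo a + \<beta>) = d"
      using x d by (auto simp: standard_def expo_deg_add expo_deg_single)
    ultimately show "p \<in> monomial ` {\<gamma>. expo_deg \<gamma> = d \<and> \<gamma> \<notin> B}"
      unfolding p A val by blast
  next
    fix p :: "('n, 'k) mpoly" assume "p \<in> monomial ` {\<gamma>. expo_deg \<gamma> = d \<and> \<gamma> \<notin> B}"
    then obtain \<gamma> where p: "p = monomial \<gamma>" and \<gamma>: "expo_deg \<gamma> = d" "\<gamma> \<notin> B" by blast
    \<comment> \<open>Splitting off the smallest index makes the symbol standard.\<close>
    define a where "a = Min (Poly_Mapping.keys \<gamma>)"
    define \<beta> where "\<beta> = \<gamma> - unit_expo a"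
    have "Poly_Mapping.keys \<gamma> \<noteq> {}" using \<gamma> d by (auto simp: expo_deg_def)
    then have a: "a \<in> Poly_Mapping.keys \<gamma>" by (simp add: a_def)
    have \<gamma>_eq: "unit_expo a + \<beta> = \<gamma>" using minus_add_unit[OF a] by (simp add: \<beta>_def add.commute)
    have deg: "expo_deg \<beta> = d - 1" using expo_deg_minus_unit[OF a] \<gamma> by (simp add: \<beta>_def)
    have "a \<le> Min (Poly_Mapping.keys \<beta>)" if "d \<noteq> 1"
    proof -
      have "Poly_Mapping.keys \<beta> \<noteq> {}" using that d deg by (auto simp: expo_deg_def)
      then show ?thesis
        using keys_minus_unit[OF a] unfolding a_def by (intro Min_antimono) (auto simp: \<beta>_def a_def)
    qed
    then have "({a}, \<beta>) \<in> standard d 0" using deg by (auto simp: standard_def)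
    moreover have "({a}, \<beta>) \<notin> excluded d B"
    proof
      assume "({a}, \<beta>) \<in> excluded d B"
      then have "\<beta> = Poly_Mapping.single a (d - 1)" "Poly_Mapping.single a d \<in> B"
        by (auto simp: excluded_iff)
      moreover from this have "\<gamma> = Poly_Mapping.single a d"
        using d by (simp flip: \<gamma>_eq single_add)
      ultimately show False using \<gamma> by simp
    qed
    ultimately show "p \<in> sym_psi ` (\<lambda>(A, \<beta>). kappa (exsym_basis A \<beta> :: ('n, 'k) exsym)) ` (standard d 0 - excluded d B)"
      unfolding p by (intro image_eqI[OF _ image_eqI[OF refl]]) (auto simp: val \<gamma>_eq)
  qed
qed

lemma sym_psi_LB:
  fixes B :: "'n::{finite, linorder} expo set"
  assumes "1 \<le> d" "\<And>\<gamma>. \<gamma> \<in> B \<Longrightarrow> \<exists>k. \<gamma> = Poly_Mapping.single k d"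
  shows "sym_psi ` LB d B 0 = (ideal_with_complement d B :: ('n, 'k::field) mpoly set)"
  unfolding LB_def ideal_with_complement_def
  by (simp only: sym_psi.span_image[symmetric] sym_psi_generators[OF assms])

lemma ideal_with_complement_irrelevant:
  assumes "1 \<le> d"
  shows "ideal_with_complement d B \<subseteq> (irrelevant_ideal :: ('n, 'k::field) mpoly set)"
  unfolding ideal_with_complement_def
proof (rule self.span_minimal)
  show "monomial ` {\<beta>. expo_deg \<beta> = d \<and> \<beta> \<notin> B} \<subseteq> (irrelevant_ideal :: ('n, 'k) mpoly set)"
  proof (rule image_subsetI)
    fix \<beta> assume "\<beta> \<in> {\<beta>. expo_deg \<beta> = d \<and> \<beta> \<notin> B}"
    then have "Poly_Mapping.keys \<beta> \<noteq> {}" using assms by (auto simp: expo_deg_def)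
    then obtain a where a: "a \<in> Poly_Mapping.keys \<beta>" by blast
    have "monomial \<beta> = monomial (\<beta> - unit_expo a) * (var a :: ('n, 'k) mpoly)"
      by (simp add: monomial_def mult_single minus_add_unit[OF a])
    then show "(monomial \<beta> :: ('n, 'k) mpoly) \<in> irrelevant_ideal"
      unfolding irrelevant_ideal_def by (metis rangeI self.span_base self.span_scale)
  qed
qed (simp add: irrelevant_ideal_def)

lemma kos_eq_0:
  fixes f :: "('n::{finite, linorder}, 'k::field) exsym"
  assumes "f \<in> exsym_part 0 b"
  shows "kos f = 0"
proof (rule ecoef_eqI, rule ccontr)
  fix \<alpha> A \<beta> assume "ecoef (kos f) \<alpha> A \<beta> \<noteq> ecoef 0 \<alpha> A \<beta>"
  then have "kdiff UNIV (\<lambda>\<alpha> A. ecoef f \<alpha> A \<beta>) \<alpha> A \<noteq> 0" by (simp add: ecoef_kos)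
  then show False by (auto dest!: in_exsym_partD[OF assms] elim!: kdiff_nonzeroE)
qed

theorem corollary6p9:
  fixes d r :: nat
    and k :: "nat \<Rightarrow> 'n::{finite, linorder}"
    and B :: "'n expo set"
    and K' :: "('n, 'k::field) mpoly set"
  assumes "1 \<le> d"
    and "1 \<le> r" and "r \<le> CARD('n)"
    and "strict_mono_on {1..r} k"
    and "\<And>s t. s \<in> {1..r} \<Longrightarrow> t \<in> {1..r} \<Longrightarrow> s \<noteq> t \<Longrightarrow>
           d + 2 \<le> expo_deg (expo_lcm (Poly_Mapping.single (k s) d) (Poly_Mapping.single (k t) d))"
    and "B = (\<lambda>s. Poly_Mapping.single (k s) d) ` {1..r}"
    and "K' = ideal_with_complement d B"
  shows "minimal_free_resolution_of_quotient exsym_scale exsym_homog (CARD('n) - 1)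
           (LB d B) (\<lambda>_. kos) sym_psi K'"
proof -
  have single_inj: "a = b" if "Poly_Mapping.single a m = Poly_Mapping.single b m" "0 < m"
    for a b :: 'n and m :: nat
  proof -
    have "Poly_Mapping.keys (Poly_Mapping.single a m) = Poly_Mapping.keys (Poly_Mapping.single b m)"
      using that by simp
    then show ?thesis using that(2) by simp
  qed
  \<comment> \<open>For a \<noteq> b the least common multiple has degree 2 d, so the hypothesis
    gives 2 \<le> d; then d - 1 is positive and the two exponents differ. In particular, B is a
    singleton if d = 1.\<close>
  have uniq: "a = b" if ab: "Poly_Mapping.single a d \<in> B" "Poly_Mapping.single b d \<in> B"
    and eq: "Poly_Mapping.single a (d - 1) = Poly_Mapping.single b (d - 1)" for a b
  proof (rule ccontr)
    assume "a \<noteq> b"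
    obtain s t where s: "s \<in> {1..r}" "Poly_Mapping.single a d = Poly_Mapping.single (k s) d"
      and t: "t \<in> {1..r}" "Poly_Mapping.single b d = Poly_Mapping.single (k t) d"
      using ab assms(6) by auto
    have st: "a = k s" "b = k t" using s t single_inj \<open>1 \<le> d\<close> by auto
    with \<open>a \<noteq> b\<close> have "s \<noteq> t" by auto
    have "expo_lcm (Poly_Mapping.single a d) (Poly_Mapping.single b d) =
        Poly_Mapping.single a d + Poly_Mapping.single b d"
      using \<open>a \<noteq> b\<close> by (intro poly_mapping_eqI) (auto simp: expo_lcm.rep_eq lookup_add lookup_single when_def)
    then have "d + 2 \<le> 2 * d"
      using assms(5)[OF s(1) t(1) \<open>s \<noteq> t\<close>] by (simp add: st expo_deg_add expo_deg_single)
    with eq single_inj \<open>a \<noteq> b\<close> show False by auto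
  qed
  have B: "\<exists>k. \<gamma> = Poly_Mapping.single k d" if "\<gamma> \<in> B" for \<gamma>
    using that assms(6) by auto
  let ?L = "LB d B :: nat \<Rightarrow> ('n, 'k) exsym set"
  have L0: "x \<in> exsym_part 0 d" if "x \<in> ?L 0" for x
    using LB_subset_L[OF \<open>1 \<le> d\<close>] that by (auto simp: L_module_def)
  \<comment> \<open>At i = n - 1 the term {0} agrees with the image of \<open>?L (Suc i)\<close>,
    which is 0 by \<open>LB_eq_0\<close>.\<close>
  have incoming: "incoming (CARD('n) - 1) ?L (\<lambda>_. kos) i = kos ` ?L (Suc i)" for i
    using LB_eq_0[OF \<open>1 \<le> d\<close>, of "Suc i" B, where 'k = 'k] by (auto simp: incoming_def)
  \<comment> \<open>One statement for all places: at i = 0 the condition \<open>kos x = 0\<close> is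
    automatic by \<open>kos_eq_0\<close>, and for i > 0 the one on \<open>sym_psi\<close> is
    void.\<close>
  have exact: "{x \<in> ?L i. kos x = 0 \<and> (i = 0 \<longrightarrow> sym_psi x = 0)} = kos ` ?L (Suc i)" for i
  proof (intro antisym subsetI)
    fix x assume "x \<in> {x \<in> ?L i. kos x = 0 \<and> (i = 0 \<longrightarrow> sym_psi x = 0)}"
    then show "x \<in> kos ` ?L (Suc i)" using LB_exact[OF \<open>1 \<le> d\<close> uniq] by blast
  next
    fix x assume x: "x \<in> kos ` ?L (Suc i)"
    then have "kos x = 0" by (auto simp: kos_kos)
    moreover have "sym_psi x = 0"
      using x by (auto simp: LB_eq[OF \<open>1 \<le> d\<close>] sym_psi_kos kappa_kappa)
    moreover have "x \<in> ?L i" using x kos_LB[OF \<open>1 \<le> d\<close>] by blast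
    ultimately show "x \<in> {x \<in> ?L i. kos x = 0 \<and> (i = 0 \<longrightarrow> sym_psi x = 0)}" by simp
  qed
  have pred: "Suc (i - 1) = i" if "i \<in> {1..CARD('n) - 1}" for i using that by auto
  show ?thesis
    unfolding minimal_free_resolution_of_quotient_def incoming
  proof (intro conjI allI ballI impI)
    show "module (exsym_scale :: ('n, 'k) mpoly \<Rightarrow> _)" by (rule module_exsym_scale)
    show "graded_free exsym_scale exsym_homog (?L i)" for i
      using \<open>1 \<le> d\<close> by (rule graded_free_LB)
    show "linear_map_on exsym_scale (*) (?L 0) sym_psi"
      by (simp add: linear_map_on_def sym_psi.add sym_psi.scale)
    show "sym_psi ` (?L 0 \<inter> exsym_homog j) \<subseteq> poly_homog j" for j
      using sym_psi_in_poly_homog L0 by blast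
    show "linear_map_on exsym_scale exsym_scale (?L i) kos" for i
      by (simp add: linear_map_on_def kos.add kos.scale)
    show "kos ` ?L i \<subseteq> ?L (i - 1)" if "i \<in> {1..CARD('n) - 1}" for i
      using kos_LB[OF \<open>1 \<le> d\<close>, of B "i - 1", where 'k = 'k] by (simp only: pred[OF that])
    show "kos ` (?L i \<inter> exsym_homog j) \<subseteq> exsym_homog j" for i j
      using kos_in_exsym_homog by blast
    show image: "sym_psi ` ?L 0 = K'"
      unfolding assms(7) using \<open>1 \<le> d\<close> B by (rule sym_psi_LB)
    show "{x \<in> ?L 0. sym_psi x = 0} = kos ` ?L (Suc 0)"
      using exact[of 0] kos_eq_0 L0 by blast
    show "{x \<in> ?L i. kos x = 0} = kos ` ?L (Suc i)" if "i \<in> {1..CARD('n) - 1}" for i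
      using exact[of i] that by simp
    show "sym_psi ` ?L 0 \<subseteq> irrelevant_ideal"
      unfolding image assms(7) using \<open>1 \<le> d\<close> by (rule ideal_with_complement_irrelevant)
    show "kos ` ?L i \<subseteq> irrelevant_mult exsym_scale (?L (i - 1))" if "i \<in> {1..CARD('n) - 1}" for i
      using kos_LB_minimal[OF \<open>1 \<le> d\<close>, of B "i - 1", where 'k = 'k] by (simp only: pred[OF that])
  qed
qed

end
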